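(* Let $\mathcal{C}$ be either $\mathrm{Ab}^{\mathrm{A}}$ (Banach Abelian groups) or $\mathrm{Ab}^{\mathrm{nA}}$ (non-Archimedean Banach Abelian groups), let $R$ be a commutative monoid object of $\mathcal{C}$, and let $X$ be a compact Hausdorff topological space. Then $\mathrm{C}(X,R)$ satisfies the Stone–Weierstrass theorem over $R$ in each of the following cases: (i) There exists an isomorphism $R \to (\mathbb{R}, |\cdot|_{\mathbb{R}}^{\epsilon})$ of monoid objects in $\mathrm{Ab}^{\mathrm{A}}$ for some $\epsilon \in [0,\infty)$. (ii) There exists an isomorphism $R \to k$ of monoid objects in $\mathrm{Ab}^{\mathrm{A}}$ for some complete non-Archimedean valued field $k$. (iii) There exists an isomorphism $R \to \mathbb{Z}_{\infty}$ or $R \to \mathbb{Z}_{\mathrm{triv}}$ of monoid objects in $\mathrm{Ab}^{\mathrm{A}}$. (iv) There exists a total order $\leq$ on the underlying ring of $R$ such that $(R,\leq)$ is an ordered ring, and $R$ is isolated at $0$.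
   Context: $\mathrm{Ab}^{\mathrm{A}}$ is the category of Banach Abelian groups: Abelian groups with a map $\|\cdot\|$ to $[0,\infty)$ such that $(m_0,m_1)\mapsto\|m_0-m_1\|$ is a complete metric, with bounded homomorphisms; $\mathrm{Ab}^{\mathrm{nA}}$ is the full subcategory of those whose metric is an ultrametric. Both are symmetric monoidal for the respective completed projective tensor product, so a commutative monoid object $R$ is a commutative unital ring with a complete (resp. complete ultrametric) norm and bounded multiplication; isomorphisms of monoid objects are ring isomorphisms bounded in both directions. $R$ is isolated at $0$ if $\{0\}\subset R$ is open. $\mathbb{Z}_\infty$ is $\mathbb{Z}$ with the Euclidean absolute value, $\mathbb{Z}_{\mathrm{triv}}$ is $\mathbb{Z}$ with the trivial norm ($1$ on non-zero elements, $0$ at $0$); $|\cdot|_{\mathbb{R}}^{0}$ means the trivial norm. $\mathrm{C}(X,R)$ is the $R$-algebra of continuous maps $X\to R$ with the supremum norm. Subrings and subalgebras are unital. A subring $B\subset\mathrm{C}(X,R)$ separates points of $X$ if for any $x_0\neq x_1$ in $X$ there is $f\in B$ with $f(x_0)\neq f(x_1)$. The $R$-algebra $A=\mathrm{C}(X,R)$ satisfies the Stone–Weierstrass theorem over $R$ if for every $R$-subalgebra $B\subset A$ separating points of $X$, the set $\{f\in A\mid \text{there exists } a\in R\setminus\{0\} \text{ with } af\in B\}$ is dense in $A$. An ordered ring is a non-zero commutative ring with a total order compatible with addition and such that the product of two (strictly) positive elements is (strictly) positive; the order is not required to be related to the norm. *)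

theory Defs
  imports
    "HOL-Analysis.Analysis"
    "HOL-Algebra.Subrings"
    "HOL-Algebra.Module"
    "HOL-Algebra.IntRing"
begin

section \<open>Banach Abelian groups and their commutative monoid objects\<close>

text \<open>
  A normed ring is a pair of a ring \<open>R\<close> of HOL-Algebra and a map \<open>N\<close> on its elements; the values
  of \<open>N\<close> outside \<open>carrier R\<close> are irrelevant. The guard in \<open>norm_dist\<close> is there because the
  locale \<open>Metric_space\<close> demands non-negativity and symmetry of the distance on the whole type.
\<close>

definition norm_dist :: "('a, 'm) ring_scheme \<Rightarrow> ('a \<Rightarrow> real) \<Rightarrow> 'a \<Rightarrow> 'a \<Rightarrow> real" where
  "norm_dist R N x y =
     (if x \<in> carrier R \<and> y \<in> carrier R then N (x \<ominus>\<^bsub>R\<^esub> y) else 0)"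

definition norm_topology :: "('a, 'm) ring_scheme \<Rightarrow> ('a \<Rightarrow> real) \<Rightarrow> 'a topology" where
  "norm_topology R N = Metric_space.mtopology (carrier R) (norm_dist R N)"

definition banach_ab_group :: "('a, 'm) ring_scheme \<Rightarrow> ('a \<Rightarrow> real) \<Rightarrow> bool" where
  "banach_ab_group R N \<longleftrightarrow>
     abelian_group R \<and>
     Metric_space (carrier R) (norm_dist R N) \<and>
     Metric_space.mcomplete (carrier R) (norm_dist R N)"

definition na_banach_ab_group :: "('a, 'm) ring_scheme \<Rightarrow> ('a \<Rightarrow> real) \<Rightarrow> bool" where
  "na_banach_ab_group R N \<longleftrightarrow>
     banach_ab_group R N \<and>
     (\<forall>x\<in>carrier R. \<forall>y\<in>carrier R. \<forall>z\<in>carrier R.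
        norm_dist R N x z \<le> max (norm_dist R N x y) (norm_dist R N y z))"

definition bounded_mult :: "('a, 'm) ring_scheme \<Rightarrow> ('a \<Rightarrow> real) \<Rightarrow> bool" where
  "bounded_mult R N \<longleftrightarrow>
     (\<exists>C. \<forall>x\<in>carrier R. \<forall>y\<in>carrier R. N (x \<otimes>\<^bsub>R\<^esub> y) \<le> C * N x * N y)"

text \<open>
  A bounded homomorphism out of the completed projective tensor product of \<open>R\<close> with itself is a
  bounded biadditive map, and the unit of a monoid object is automatically bounded, so the
  commutative monoid objects of the two categories are the following. The zero ring is allowed.
\<close>

definition comm_monoid_AbA :: "('a, 'm) ring_scheme \<Rightarrow> ('a \<Rightarrow> real) \<Rightarrow> bool" where
  "comm_monoid_AbA R N \<longleftrightarrow> cring R \<and> banach_ab_group R N \<and> bounded_mult R N"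

definition comm_monoid_AbnA :: "('a, 'm) ring_scheme \<Rightarrow> ('a \<Rightarrow> real) \<Rightarrow> bool" where
  "comm_monoid_AbnA R N \<longleftrightarrow> cring R \<and> na_banach_ab_group R N \<and> bounded_mult R N"

definition bounded_map ::
  "('a, 'm) ring_scheme \<Rightarrow> ('a \<Rightarrow> real) \<Rightarrow> ('b \<Rightarrow> real) \<Rightarrow> ('a \<Rightarrow> 'b) \<Rightarrow> bool" where
  "bounded_map R N N' h \<longleftrightarrow> (\<exists>C. \<forall>x\<in>carrier R. N' (h x) \<le> C * N x)"

definition monoid_iso_AbA ::
  "('a, 'm) ring_scheme \<Rightarrow> ('a \<Rightarrow> real) \<Rightarrow> ('b, 'n) ring_scheme \<Rightarrow> ('b \<Rightarrow> real) \<Rightarrow>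
   ('a \<Rightarrow> 'b) \<Rightarrow> bool" where
  "monoid_iso_AbA R N S N' h \<longleftrightarrow>
     comm_monoid_AbA R N \<and> comm_monoid_AbA S N' \<and>
     h \<in> ring_iso R S \<and>
     bounded_map R N N' h \<and>
     bounded_map S N' N (inv_into (carrier R) h)"

section \<open>The rings occurring in the hypotheses\<close>

definition real_ring :: "real ring" where
  "real_ring = \<lparr>carrier = UNIV, mult = (*), one = 1, zero = 0, add = (+)\<rparr>"

text \<open>
  As \<open>0 powr e = 0\<close> for every \<open>e\<close>, the exponent \<open>0\<close> gives the trivial norm. For \<open>e > 1\<close> the triangle
  inequality fails, so no isomorphism of monoid objects onto \<open>(real_ring, real_pow_norm e)\<close> exists.
\<close>

definition real_pow_norm :: "real \<Rightarrow> real \<Rightarrow> real" where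
  "real_pow_norm e x = \<bar>x\<bar> powr e"

definition int_norm_inf :: "int \<Rightarrow> real" where
  "int_norm_inf n = \<bar>real_of_int n\<bar>"

definition int_norm_triv :: "int \<Rightarrow> real" where
  "int_norm_triv n = (if n = 0 then 0 else 1)"

text \<open>Trivially valued fields are included.\<close>

definition complete_na_valued_field :: "('a, 'm) ring_scheme \<Rightarrow> ('a \<Rightarrow> real) \<Rightarrow> bool" where
  "complete_na_valued_field K v \<longleftrightarrow>
     field K \<and> na_banach_ab_group K v \<and>
     (\<forall>x\<in>carrier K. \<forall>y\<in>carrier K. v (x \<otimes>\<^bsub>K\<^esub> y) = v x * v y)"

definition isolated_at_zero :: "('a, 'm) ring_scheme \<Rightarrow> ('a \<Rightarrow> real) \<Rightarrow> bool" where
  "isolated_at_zero R N \<longleftrightarrow> openin (norm_topology R N) {\<zero>\<^bsub>R\<^esub>}"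

definition ordered_cring :: "('a, 'm) ring_scheme \<Rightarrow> 'a rel \<Rightarrow> bool" where
  "ordered_cring R r \<longleftrightarrow>
     cring R \<and> \<one>\<^bsub>R\<^esub> \<noteq> \<zero>\<^bsub>R\<^esub> \<and>
     linear_order_on (carrier R) r \<and>
     (\<forall>a\<in>carrier R. \<forall>b\<in>carrier R. \<forall>c\<in>carrier R.
        (a, b) \<in> r \<longrightarrow> (a \<oplus>\<^bsub>R\<^esub> c, b \<oplus>\<^bsub>R\<^esub> c) \<in> r) \<and>
     (\<forall>a\<in>carrier R. \<forall>b\<in>carrier R.
        (\<zero>\<^bsub>R\<^esub>, a) \<in> r \<and> a \<noteq> \<zero>\<^bsub>R\<^esub> \<and> (\<zero>\<^bsub>R\<^esub>, b) \<in> r \<and> b \<noteq> \<zero>\<^bsub>R\<^esub> \<longrightarrow>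
        (\<zero>\<^bsub>R\<^esub>, a \<otimes>\<^bsub>R\<^esub> b) \<in> r \<and> a \<otimes>\<^bsub>R\<^esub> b \<noteq> \<zero>\<^bsub>R\<^esub>)"

section \<open>Algebras of continuous functions and the Stone--Weierstrass theorem\<close>

text \<open>
  Functions on \<open>topspace X\<close> are represented by total functions that are \<open>undefined\<close> elsewhere, so
  that equality in the carrier is equality of functions on \<open>topspace X\<close>.
\<close>

definition C_alg ::
  "'x topology \<Rightarrow> ('a, 'm) ring_scheme \<Rightarrow> ('a \<Rightarrow> real) \<Rightarrow> ('a, 'x \<Rightarrow> 'a) module" where
  "C_alg X R N =
     \<lparr>carrier = {f \<in> extensional (topspace X). continuous_map X (norm_topology R N) f},
      mult = (\<lambda>f g. \<lambda>x\<in>topspace X. f x \<otimes>\<^bsub>R\<^esub> g x),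
      one = (\<lambda>x\<in>topspace X. \<one>\<^bsub>R\<^esub>),
      zero = (\<lambda>x\<in>topspace X. \<zero>\<^bsub>R\<^esub>),
      add = (\<lambda>f g. \<lambda>x\<in>topspace X. f x \<oplus>\<^bsub>R\<^esub> g x),
      smult = (\<lambda>a f. \<lambda>x\<in>topspace X. a \<otimes>\<^bsub>R\<^esub> f x)\<rparr>"

text \<open>The inserted \<open>0\<close> only matters for empty \<open>X\<close>, where the supremum norm is \<open>0\<close>.\<close>

definition sup_norm :: "'x topology \<Rightarrow> ('a \<Rightarrow> real) \<Rightarrow> ('x \<Rightarrow> 'a) \<Rightarrow> real" where
  "sup_norm X N f = Sup (insert 0 ((\<lambda>x. N (f x)) ` topspace X))"

definition subalgebra_of :: "'b set \<Rightarrow> ('a, 'm) ring_scheme \<Rightarrow> ('a, 'b) module \<Rightarrow> bool" where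
  "subalgebra_of B R A \<longleftrightarrow> subring B A \<and> submodule B R A"

definition separates_points :: "'x topology \<Rightarrow> ('x \<Rightarrow> 'a) set \<Rightarrow> bool" where
  "separates_points X B \<longleftrightarrow>
     (\<forall>x0\<in>topspace X. \<forall>x1\<in>topspace X. x0 \<noteq> x1 \<longrightarrow> (\<exists>f\<in>B. f x0 \<noteq> f x1))"

definition satisfies_stone_weierstrass ::
  "'x topology \<Rightarrow> ('a, 'm) ring_scheme \<Rightarrow> ('a \<Rightarrow> real) \<Rightarrow> bool" where
  "satisfies_stone_weierstrass X R N \<longleftrightarrow>
     (\<forall>B. subalgebra_of B R (C_alg X R N) \<and> separates_points X B \<longrightarrow>
        norm_topology (C_alg X R N) (sup_norm X N) closure_of
          {f \<in> carrier (C_alg X R N).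
             \<exists>a\<in>carrier R - {\<zero>\<^bsub>R\<^esub>}. a \<odot>\<^bsub>C_alg X R N\<^esub> f \<in> B}
        = carrier (C_alg X R N))"

end

theory Submission
  imports Defs
begin

text \<open>
  Approximability on a closed subset of a compact space is inherited by a neighbourhood, so by
  Zorn's lemma it suffices to glue: if a closed set \<open>S\<close> has two points and \<open>f\<close> is approximable
  on all its proper closed subsets, then \<open>f\<close> is approximable on \<open>S\<close>. An element \<open>h\<close> of the
  algebra that is not constant on \<open>S\<close> yields two proper closed subsets covering \<open>S\<close> and, through
  powers, an element of the algebra passing from almost \<open>1\<close> on one to almost \<open>0\<close> on the other,
  with which the two approximations are combined. For \<open>\<real>\<close> this is Ransford's argument.

  The other cases are treated together. Let \<open>R\<close> be a domain with a continuous multiplicative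
  ultrametric norm \<open>v\<close>. The gluing works without divisions, at the price of approximating a
  multiple \<open>a f\<close> up to \<open>\<epsilon> v(a)\<close>. In a field one divides by \<open>a\<close>; in a discrete domain one takes
  the trivial norm for \<open>v\<close>, and the approximation is an equality. Ordered rings are domains.
\<close>

section \<open>Localisation on compact spaces and the real case\<close>

text \<open>The obstacle is the missing division. Over the integers, a function with values 0 and 2
  generates only functions whose two values are congruent mod 2, so a function with values 0 and 1
  is out of reach, while its double is present. Hence a transition function \<open>e\<close> is
  compared with some nonzero \<open>a\<close> instead of 1, and every approximation carries a
  denominator. The condition \<open>v (a \<otimes> f x \<ominus> g x) < \<epsilon> * v a\<close> is
  homogeneous: multiplying \<open>a\<close> and \<open>g\<close> by a nonzero constant scales both
  sides alike. Approximations with different denominators can therefore be brought to a common one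
  without loss. This requires exact multiplicativity, whereas \<open>N\<close> satisfies its product
  inequality only up to a constant; so \<open>v\<close> is kept apart from \<open>N\<close>. The two
  gluings differ in shape. In the ultrametric case the sets to be separated are disjoint and both
  closed. Over the reals the space may be connected, so the two closed sets overlap, and convexity
  controls the error in between.\<close>

lemma compact_space_induct_local:
  assumes X: "compact_space X"
    and empty: "P {}"
    and point: "\<And>x. x \<in> topspace X \<Longrightarrow> P {x}"
    and nhd: "\<And>S. closedin X S \<Longrightarrow> P S \<Longrightarrow>
      \<exists>U. openin X U \<and> S \<subseteq> U \<and> (\<forall>T. closedin X T \<and> T \<subseteq> U \<longrightarrow> P T)"
    and glue: "\<And>S x y. closedin X S \<Longrightarrow> x \<in> S \<Longrightarrow> y \<in> S \<Longrightarrow> x \<noteq> y \<Longrightarrow>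
      (\<And>T. closedin X T \<Longrightarrow> T \<subset> S \<Longrightarrow> P T) \<Longrightarrow> P S"
  shows "P (topspace X)"
proof (rule ccontr)
  assume neg: "\<not> P (topspace X)"
  \<comment> \<open>Complements are used because Zorn's lemma yields maximal elements: a maximal
    open set in \<open>\<A>\<close> is the complement of a minimal closed set violating
    \<open>P\<close>.\<close>
  define \<A> where "\<A> = {V. openin X V \<and> \<not> P (topspace X - V)}"
  have "\<exists>M\<in>\<A>. \<forall>V\<in>\<A>. M \<subseteq> V \<longrightarrow> V = M"
  proof (rule subset_Zorn_nonempty)
    show "\<A> \<noteq> {}" using neg by (auto simp: \<A>_def intro!: exI[of _ "{}"])
    fix \<C> assume ne: "\<C> \<noteq> {}" and ch: "subset.chain \<A> \<C>"
    have sub: "\<C> \<subseteq> \<A>" using ch by (simp add: subset_chain_def)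
    have op: "openin X (\<Union>\<C>)" using sub by (auto simp: \<A>_def)
    have "\<not> P (topspace X - \<Union>\<C>)"
    proof
      assume "P (topspace X - \<Union>\<C>)"
      then obtain U where U: "openin X U" "topspace X - \<Union>\<C> \<subseteq> U"
          "\<And>T. closedin X T \<Longrightarrow> T \<subseteq> U \<Longrightarrow> P T"
        using nhd[of "topspace X - \<Union>\<C>"] op by blast
      \<comment> \<open>By compactness one closed set of the chain already lies inside the
        neighbourhood \<open>U\<close> of the intersection, and there \<open>P\<close> is
        known.\<close>
      have co: "compactin X (topspace X - U)"
        by (rule closedin_compact_space[OF X]) (use U(1) in blast)
      obtain \<F> where \<F>: "finite \<F>" "\<F> \<subseteq> \<C>" "topspace X - U \<subseteq> \<Union>\<F>"
      proof -
        have "\<And>V. V \<in> \<C> \<Longrightarrow> openin X V" using sub by (auto simp: \<A>_def)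
        moreover have "topspace X - U \<subseteq> \<Union>\<C>" using U(2) by auto
        ultimately show thesis using compactinD[OF co] that by meson
      qed
      \<comment> \<open>A finite nonempty part of a chain contains its own union; if the finite
        cover is empty, any member of the chain will do.\<close>
      have "\<exists>V\<in>\<C>. topspace X - U \<subseteq> V"
      proof (cases "\<F> = {}")
        case True then show ?thesis using \<F> ne by auto
      next
        case False
        have "subset.chain \<A> \<F>" using ch \<F>(2) unfolding subset_chain_def by (meson subset_iff)
        then have "\<Union>\<F> \<in> \<F>"
          using Union_in_chain[OF \<F>(1) False] by blast
        then show ?thesis using \<F> by auto
      qed
      then obtain V where "V \<in> \<C>" "topspace X - V \<subseteq> U" by auto
      then show False using U(3)[of "topspace X - V"] sub unfolding \<A>_def by auto
    qed
    then show "\<Union>\<C> \<in> \<A>" using op by (simp add: \<A>_def)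
  qed
  then obtain M where M: "openin X M" "\<not> P (topspace X - M)"
      and max: "\<And>V. V \<in> \<A> \<Longrightarrow> M \<subseteq> V \<Longrightarrow> V = M"
    unfolding \<A>_def by blast
  define S where "S = topspace X - M"
  have S: "closedin X S" "\<not> P S" using M by (auto simp: S_def)
  have min: "P T" if "closedin X T" "T \<subset> S" for T
  proof (rule ccontr)
    assume "\<not> P T"
    then have "topspace X - T \<in> \<A>"
      using that closedin_subset[OF that(1)] by (auto simp: \<A>_def double_diff)
    moreover have "M \<subset> topspace X - T"
      using that openin_subset[OF M(1)] by (auto simp: S_def)
    ultimately show False using max by blast
  qed
  show False
  proof (cases "\<exists>x\<in>S. \<exists>y\<in>S. x \<noteq> y")
    case True
    then show False using glue[OF S(1)] min S(2) by blast
  next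
    case False
    then have "S = {} \<or> (\<exists>x. S = {x})" by blast
    then show False using S empty point closedin_subset[OF S(1)] by auto
  qed
qed

section \<open>Extrema on compact sets, a polynomial step function, and real approximation\<close>

lemma compactin_attains_sup:
  fixes u :: "'x \<Rightarrow> real"
  assumes "compactin X S" "continuous_map X euclideanreal u" "S \<noteq> {}"
  obtains x where "x \<in> S" "\<And>y. y \<in> S \<Longrightarrow> u y \<le> u x"
proof -
  have "compact (u ` S)" using image_compactin[OF assms(1,2)] by simp
  then show thesis using compact_attains_sup[of "u ` S"] assms(3) that by auto
qed

lemma compactin_attains_inf:
  fixes u :: "'x \<Rightarrow> real"
  assumes "compactin X S" "continuous_map X euclideanreal u" "S \<noteq> {}"
  obtains x where "x \<in> S" "\<And>y. y \<in> S \<Longrightarrow> u x \<le> u y"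
proof -
  have "compact (u ` S)" using image_compactin[OF assms(1,2)] by simp
  then show thesis using compact_attains_inf[of "u ` S"] assms(3) that by auto
qed

text \<open>A maximum is attained, so a pointwise strict bound leaves a uniform gap. On the empty
  set the bound is \<open>c - 1\<close>, which may be negative.\<close>

lemma compactin_uniform_less:
  fixes u :: "'x \<Rightarrow> real"
  assumes "compactin X S" "continuous_map X euclideanreal u" "\<And>x. x \<in> S \<Longrightarrow> u x < c"
  obtains d where "d < c" "\<And>x. x \<in> S \<Longrightarrow> u x \<le> d"
proof (cases "S = {}")
  case True then show thesis using that[of "c - 1"] by simp
next
  case False
  then show thesis using compactin_attains_sup[OF assms(1,2)] assms(3) that by metis
qed

lemma openin_less_continuous_map:
  fixes u :: "'x \<Rightarrow> real"
  assumes "continuous_map X euclideanreal u"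
  shows "openin X {x \<in> topspace X. u x < c}"
  using assms by (simp add: continuous_map_upper_lower_semicontinuous_lt)

lemma closedin_le_continuous_map:
  fixes u :: "'x \<Rightarrow> real"
  assumes "continuous_map X euclideanreal u"
  shows "closedin X {x \<in> topspace X. u x \<le> c}" "closedin X {x \<in> topspace X. c \<le> u x}"
  using assms by (simp_all add: continuous_map_upper_lower_semicontinuous_le)

text \<open>The exponent \<open>2 ^ n\<close> works because 1/2 lies between the thresholds:
  \<open>2 ^ n * t ^ n\<close> is at most \<open>(2/3) ^ n\<close> for \<open>t \<le> 1/3\<close>
  and at least \<open>(4/3) ^ n\<close> for \<open>t \<ge> 2/3\<close>. Bernoulli's inequality
  settles the first range directly. In the second it bounds \<open>(1 + t ^ n) ^ 2 ^ n\<close> from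
  below, and \<open>(1 - s) * (1 + s) \<le> 1\<close> turns this into an upper bound for the other
  factor.\<close>

lemma step_power_bounds:
  fixes t :: real
  assumes "0 \<le> t" "t \<le> 1"
  shows "0 \<le> (1 - t ^ n) ^ 2 ^ n" "(1 - t ^ n) ^ 2 ^ n \<le> 1"
    and "t \<le> 1/3 \<Longrightarrow> 1 - (1 - t ^ n) ^ 2 ^ n \<le> (2/3) ^ n"
    and "2/3 \<le> t \<Longrightarrow> (1 - t ^ n) ^ 2 ^ n \<le> (3/4) ^ n"
proof -
  have t: "0 \<le> t ^ n" "t ^ n \<le> 1" using assms by (auto simp: power_le_one)
  then show "0 \<le> (1 - t ^ n) ^ 2 ^ n" "(1 - t ^ n) ^ 2 ^ n \<le> 1" by (auto simp: power_le_one)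
  have B: "1 + real (2 ^ n) * x \<le> (1 + x) ^ 2 ^ n" if "x \<ge> -1" for x :: real
    using Bernoulli_inequality[OF that, of "2 ^ n"] by simp
  show "1 - (1 - t ^ n) ^ 2 ^ n \<le> (2/3) ^ n" if "t \<le> 1/3"
  proof -
    have "2 ^ n * t ^ n \<le> 2 ^ n * (1/3) ^ n"
      using that assms by (intro mult_left_mono power_mono) auto
    also have "\<dots> = (2/3) ^ n" by (simp add: power_divide)
    finally show ?thesis using B[of "- (t ^ n)"] t by simp
  qed
  show "(1 - t ^ n) ^ 2 ^ n \<le> (3/4) ^ n" if "2/3 \<le> t"
  proof -
    have "(4/3) ^ n = 2 ^ n * (2/3::real) ^ n" by (simp add: power_divide power_mult_distrib[symmetric])
    also have "\<dots> \<le> 2 ^ n * t ^ n" using that by (intro mult_left_mono power_mono) auto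
    also have "\<dots> \<le> (1 + t ^ n) ^ 2 ^ n" using B[of "t ^ n"] t by simp
    finally have g: "(4/3) ^ n \<le> (1 + t ^ n) ^ 2 ^ n" .
    have "(1 - t ^ n) ^ 2 ^ n * (4/3) ^ n \<le> (1 - t ^ n) ^ 2 ^ n * (1 + t ^ n) ^ 2 ^ n"
      using g t by (intro mult_left_mono) auto
    also have "\<dots> = ((1 - t ^ n) * (1 + t ^ n)) ^ 2 ^ n" by (simp add: power_mult_distrib)
    also have "\<dots> \<le> 1"
    proof (rule power_le_one)
      have "(1 - t ^ n) * (1 + t ^ n) = 1 - t ^ n * t ^ n" by (simp add: algebra_simps)
      also have "\<dots> \<le> 1" using t by simp
      finally show "(1 - t ^ n) * (1 + t ^ n) \<le> 1" .
    qed (use t in auto)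
    finally have le: "(1 - t ^ n) ^ 2 ^ n * (4/3) ^ n \<le> 1" .
    have "(1 - t ^ n) ^ 2 ^ n \<le> 1 / (4/3) ^ n"
      using le by (subst pos_le_divide_eq) auto
    also have "\<dots> = (3/4) ^ n" by (simp add: power_one_over[symmetric] power_divide)
    finally show ?thesis .
  qed
qed

lemma stone_weierstrass_real:
  fixes D :: "('x \<Rightarrow> real) set"
  assumes X: "compact_space X"
    and cont: "\<And>g. g \<in> D \<Longrightarrow> continuous_map X euclideanreal g"
    and const: "\<And>c. (\<lambda>_. c) \<in> D"
    and add: "\<And>g h. g \<in> D \<Longrightarrow> h \<in> D \<Longrightarrow> (\<lambda>x. g x + h x) \<in> D"
    and mult: "\<And>g h. g \<in> D \<Longrightarrow> h \<in> D \<Longrightarrow> (\<lambda>x. g x * h x) \<in> D"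
    and sep: "separates_points X D"
    and f: "continuous_map X euclideanreal f" and \<epsilon>: "\<epsilon> > 0"
  shows "\<exists>g\<in>D. \<forall>x\<in>topspace X. \<bar>f x - g x\<bar> < \<epsilon>"
proof (rule compact_space_induct_local[OF X, where P = "\<lambda>S. \<exists>g\<in>D. \<forall>x\<in>S. \<bar>f x - g x\<bar> < \<epsilon>"])
  have diff: "(\<lambda>x. g x - h x) \<in> D" if "g \<in> D" "h \<in> D" for g h
    using add[OF that(1) mult[OF const[of "-1"] that(2)]] by simp
  have pow: "(\<lambda>x. g x ^ n) \<in> D" if "g \<in> D" for g n
  proof (induction n)
    case 0 show ?case using const[of 1] by simp
  next
    case (Suc n) show ?case using mult[OF that Suc] by simp
  qed
  show "\<exists>g\<in>D. \<forall>x\<in>{}. \<bar>f x - g x\<bar> < \<epsilon>" using const by blast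
  show "\<exists>g\<in>D. \<forall>x\<in>{z}. \<bar>f x - g x\<bar> < \<epsilon>" for z
    by (rule bexI[OF _ const[of "f z"]]) (simp add: \<epsilon>)
  have cont_err: "continuous_map X euclideanreal (\<lambda>x. \<bar>f x - g x\<bar>)" if "g \<in> D" for g
    using cont[OF that] f by (intro continuous_intros)
  show "\<exists>U. openin X U \<and> S \<subseteq> U \<and>
      (\<forall>T. closedin X T \<and> T \<subseteq> U \<longrightarrow> (\<exists>g\<in>D. \<forall>x\<in>T. \<bar>f x - g x\<bar> < \<epsilon>))"
    if S: "closedin X S" and ex: "\<exists>g\<in>D. \<forall>x\<in>S. \<bar>f x - g x\<bar> < \<epsilon>" for S
  proof -
    obtain g where g: "g \<in> D" "\<forall>x\<in>S. \<bar>f x - g x\<bar> < \<epsilon>" using ex by blast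
    show ?thesis
      using openin_less_continuous_map[OF cont_err[OF g(1)], of \<epsilon>] g closedin_subset[OF S]
      by (intro exI[of _ "{x \<in> topspace X. \<bar>f x - g x\<bar> < \<epsilon>}"]) blast
  qed
  show "\<exists>g\<in>D. \<forall>x\<in>S. \<bar>f x - g x\<bar> < \<epsilon>"
    if S: "closedin X S" and xy: "x0 \<in> S" "y0 \<in> S" "x0 \<noteq> y0"
      and IH: "\<And>T. closedin X T \<Longrightarrow> T \<subset> S \<Longrightarrow> \<exists>g\<in>D. \<forall>x\<in>T. \<bar>f x - g x\<bar> < \<epsilon>"
    for S x0 y0
  proof -
    have SX: "S \<subseteq> topspace X" and Sc: "compactin X S"
      using S X by (auto simp: closedin_subset closedin_compact_space)
    obtain k where k: "k \<in> D" "k x0 \<noteq> k y0"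
      using sep xy SX unfolding separates_points_def by blast
    obtain a where a: "a \<in> S" "\<And>y. y \<in> S \<Longrightarrow> k a \<le> k y"
      using compactin_attains_inf[OF Sc cont[OF k(1)]] xy by blast
    obtain b where b: "b \<in> S" "\<And>y. y \<in> S \<Longrightarrow> k y \<le> k b"
      using compactin_attains_sup[OF Sc cont[OF k(1)]] xy by blast
    have ab: "k a < k b" using a b k(2) xy by (smt (verit))
    \<comment> \<open>Normalising between the extreme values of \<open>k\<close> on \<open>S\<close>
      makes \<open>h\<close> attain both 0 and 1 on \<open>S\<close>; so \<open>S1\<close> misses
      \<open>b\<close>, \<open>S2\<close> misses \<open>a\<close>, and both are proper
      subsets.\<close>
    define h where "h = (\<lambda>x. (1 / (k b - k a)) * (k x - k a))"
    have hD: "h \<in> D" unfolding h_def by (intro mult const diff k)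
    have h01: "0 \<le> h x" "h x \<le> 1" if "x \<in> S" for x
      using a(2)[OF that] b(2)[OF that] ab by (auto simp: h_def)
    have hab: "h a = 0" "h b = 1" using ab by (auto simp: h_def)
    \<comment> \<open>The sets overlap where \<open>h\<close> is between 1/3 and 2/3. Nothing better
      than \<open>0 \<le> e x \<le> 1\<close> is known there, but both approximations are good, and
      so is any convex combination of them.\<close>
    define S1 where "S1 = S \<inter> {x \<in> topspace X. h x \<le> 2/3}"
    define S2 where "S2 = S \<inter> {x \<in> topspace X. 1/3 \<le> h x}"
    have cl: "closedin X S1" "closedin X S2"
      unfolding S1_def S2_def
      by (intro closedin_Int S closedin_le_continuous_map[OF cont[OF hD]])+
    have "b \<in> S - S1" "a \<in> S - S2" using a b hab by (auto simp: S1_def S2_def)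
    then have "S1 \<subset> S" "S2 \<subset> S" by (auto simp: S1_def S2_def)
    then obtain g1 g2 where g: "g1 \<in> D" "g2 \<in> D"
        "\<And>x. x \<in> S1 \<Longrightarrow> \<bar>f x - g1 x\<bar> < \<epsilon>" "\<And>x. x \<in> S2 \<Longrightarrow> \<bar>f x - g2 x\<bar> < \<epsilon>"
      using IH cl by meson
    obtain d1 where d1: "d1 < \<epsilon>" "\<And>x. x \<in> S1 \<Longrightarrow> \<bar>f x - g1 x\<bar> \<le> d1"
      using compactin_uniform_less[OF closedin_compact_space[OF X cl(1)] cont_err[OF g(1)] g(3)] by blast
    obtain d2 where d2: "d2 < \<epsilon>" "\<And>x. x \<in> S2 \<Longrightarrow> \<bar>f x - g2 x\<bar> \<le> d2"
      using compactin_uniform_less[OF closedin_compact_space[OF X cl(2)] cont_err[OF g(2)] g(4)] by blast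
    obtain z1 where z1: "\<And>x. x \<in> S \<Longrightarrow> \<bar>f x - g1 x\<bar> \<le> \<bar>f z1 - g1 z1\<bar>"
      using compactin_attains_sup[OF Sc cont_err[OF g(1)]] xy by blast
    obtain z2 where z2: "\<And>x. x \<in> S \<Longrightarrow> \<bar>f x - g2 x\<bar> \<le> \<bar>f z2 - g2 z2\<bar>"
      using compactin_attains_sup[OF Sc cont_err[OF g(2)]] xy by blast
    \<comment> \<open>On its own set each approximation is within \<open>d\<close>; outside it only
      the bound \<open>K\<close> is available. The gap \<open>\<epsilon> - d\<close> has to absorb
      \<open>K\<close> times the small weight of the wrong approximation.\<close>
    define d K where "d = max 0 (max d1 d2)" and "K = max \<bar>f z1 - g1 z1\<bar> \<bar>f z2 - g2 z2\<bar>"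
    have d: "0 \<le> d" "d < \<epsilon>" "\<And>x. x \<in> S1 \<Longrightarrow> \<bar>f x - g1 x\<bar> \<le> d" "\<And>x. x \<in> S2 \<Longrightarrow> \<bar>f x - g2 x\<bar> \<le> d"
      unfolding d_def using \<epsilon> d1 d2 by (simp_all add: le_max_iff_disj)
    have K: "\<And>x. x \<in> S \<Longrightarrow> \<bar>f x - g1 x\<bar> \<le> K" "\<And>x. x \<in> S \<Longrightarrow> \<bar>f x - g2 x\<bar> \<le> K" "0 \<le> K"
      unfolding K_def using z1 z2 by (simp_all add: le_max_iff_disj)
    have "(\<lambda>n. (3/4) ^ n * K) \<longlonglongrightarrow> 0 * K" by (intro tendsto_intros LIMSEQ_power_zero) auto
    then have "\<forall>\<^sub>F n in sequentially. (3/4) ^ n * K < \<epsilon> - d"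
      using d by (intro order_tendstoD) auto
    then obtain n where n: "(3/4) ^ n * K < \<epsilon> - d" by (auto simp: eventually_sequentially)
    have n': "(2/3) ^ n * K < \<epsilon> - d"
    proof -
      have "(2/3) ^ n * K \<le> (3/4) ^ n * K" using K by (intro mult_right_mono power_mono) auto
      then show ?thesis using n by simp
    qed
    define e where "e = (\<lambda>x. (1 - h x ^ n) ^ 2 ^ n)"
    have eD: "e \<in> D" unfolding e_def by (intro pow diff const hD)
    define g where "g = (\<lambda>x. e x * g1 x + (1 - e x) * g2 x)"
    have gD: "g \<in> D" unfolding g_def by (intro add mult diff const eD \<open>g1 \<in> D\<close> \<open>g2 \<in> D\<close>)
    have "\<bar>f x - g x\<bar> < \<epsilon>" if x: "x \<in> S" for x
    proof -
      have eb: "0 \<le> e x" "e x \<le> 1" "h x \<le> 1/3 \<Longrightarrow> 1 - e x \<le> (2/3) ^ n" "2/3 \<le> h x \<Longrightarrow> e x \<le> (3/4) ^ n"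
        using step_power_bounds[OF h01[OF x], of n] unfolding e_def by blast+
      have "f x - g x = e x * (f x - g1 x) + (1 - e x) * (f x - g2 x)"
        by (simp add: g_def algebra_simps)
      then have le: "\<bar>f x - g x\<bar> \<le> e x * \<bar>f x - g1 x\<bar> + (1 - e x) * \<bar>f x - g2 x\<bar>"
        using eb(1,2) abs_triangle_ineq[of "e x * (f x - g1 x)" "(1 - e x) * (f x - g2 x)"]
        by (simp add: abs_mult)
      consider "h x \<le> 1/3" | "1/3 < h x" "h x < 2/3" | "2/3 \<le> h x" by linarith
      then show ?thesis
      proof cases
        case 1
        then have "\<bar>f x - g1 x\<bar> \<le> d" using x SX by (intro d) (auto simp: S1_def)
        then have A: "e x * \<bar>f x - g1 x\<bar> \<le> 1 * d" using eb by (intro mult_mono) auto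
        have B: "(1 - e x) * \<bar>f x - g2 x\<bar> \<le> (2/3) ^ n * K"
          using eb 1 K x by (intro mult_mono) auto
        show ?thesis using A B le n' by simp
      next
        case 2
        then have "\<bar>f x - g1 x\<bar> \<le> d" "\<bar>f x - g2 x\<bar> \<le> d"
          using x SX by (auto intro!: d simp: S1_def S2_def)
        then have "e x * \<bar>f x - g1 x\<bar> \<le> e x * d" "(1 - e x) * \<bar>f x - g2 x\<bar> \<le> (1 - e x) * d"
          using eb by (auto intro!: mult_left_mono)
        then have "\<bar>f x - g x\<bar> \<le> d" using le by (simp add: algebra_simps)
        then show ?thesis using d by simp
      next
        case 3
        then have "\<bar>f x - g2 x\<bar> \<le> d" using x SX by (intro d) (auto simp: S2_def)
        then have A: "(1 - e x) * \<bar>f x - g2 x\<bar> \<le> 1 * d" using eb by (intro mult_mono) auto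
        have B: "e x * \<bar>f x - g1 x\<bar> \<le> (3/4) ^ n * K"
          using eb 3 K x by (intro mult_mono) auto
        show ?thesis using A B le n by simp
      qed
    qed
    then show ?thesis using gD by blast
  qed
qed

section \<open>Continuous functions with values in a normed ring\<close>

text \<open>The laws of a norm are recovered from the metric axioms by taking one of the points to
  be zero; subadditivity is the triangle inequality for \<open>x\<close>, zero and
  \<open>\<ominus> y\<close>.\<close>

locale normed_cring = cring R for R (structure) +
  fixes N :: "'a \<Rightarrow> real"
  assumes norm_metric: "Metric_space (carrier R) (norm_dist R N)"
    and norm_mult_bounded: "bounded_mult R N"
begin

interpretation M: Metric_space "carrier R" "norm_dist R N"
  by (rule norm_metric)

lemma norm_dist_eq: "x \<in> carrier R \<Longrightarrow> y \<in> carrier R \<Longrightarrow> norm_dist R N x y = N (x \<ominus> y)"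
  by (simp add: norm_dist_def)

lemma norm_nonneg: "x \<in> carrier R \<Longrightarrow> 0 \<le> N x"
  using M.nonneg[of x \<zero>] by (simp add: norm_dist_eq minus_eq)

lemma norm_zero_iff: "x \<in> carrier R \<Longrightarrow> N x = 0 \<longleftrightarrow> x = \<zero>"
  using M.zero[of x \<zero>] by (simp add: norm_dist_eq minus_eq)

lemma norm_neg: "x \<in> carrier R \<Longrightarrow> N (\<ominus> x) = N x"
  using M.commute[of x \<zero>] by (simp add: norm_dist_eq minus_eq)

lemma norm_add: "x \<in> carrier R \<Longrightarrow> y \<in> carrier R \<Longrightarrow> N (x \<oplus> y) \<le> N x + N y"
  using M.triangle[of x \<zero> "\<ominus> y"] norm_neg[of y] by (simp add: norm_dist_eq minus_eq)

lemma norm_mult: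
  obtains C where "0 \<le> C"
    "\<And>x y. x \<in> carrier R \<Longrightarrow> y \<in> carrier R \<Longrightarrow> N (x \<otimes> y) \<le> C * N x * N y"
proof -
  obtain C where C: "\<And>x y. x \<in> carrier R \<Longrightarrow> y \<in> carrier R \<Longrightarrow> N (x \<otimes> y) \<le> C * N x * N y"
    using norm_mult_bounded unfolding bounded_mult_def by blast
  have "N (x \<otimes> y) \<le> \<bar>C\<bar> * N x * N y" if "x \<in> carrier R" "y \<in> carrier R" for x y
  proof -
    have "C * (N x * N y) \<le> \<bar>C\<bar> * (N x * N y)"
      using that by (intro mult_right_mono mult_nonneg_nonneg norm_nonneg) auto
    then show ?thesis using C[OF that] by (simp add: mult.assoc)
  qed
  then show thesis using that[of "\<bar>C\<bar>"] by simp
qed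

lemma norm_minus_swap: "x \<in> carrier R \<Longrightarrow> y \<in> carrier R \<Longrightarrow> N (x \<ominus> y) = N (y \<ominus> x)"
  using M.commute[of x y] by (simp add: norm_dist_eq)

lemma topspace_norm_topology: "topspace (norm_topology R N) = carrier R"
  by (simp add: norm_topology_def)

lemma continuous_map_norm_topology_iff:
  "continuous_map X (norm_topology R N) f \<longleftrightarrow>
     (\<forall>x\<in>topspace X. f x \<in> carrier R) \<and>
     (\<forall>x\<in>topspace X. \<forall>e>0. \<exists>U. openin X U \<and> x \<in> U \<and> (\<forall>y\<in>U. N (f y \<ominus> f x) < e))"
    (is "?L \<longleftrightarrow> ?R")
proof
  assume L: ?L
  have R0: "f x \<in> carrier R" if "x \<in> topspace X" for x
    using continuous_map_funspace[OF L] that by (auto simp: norm_topology_def)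
  have "\<exists>U. openin X U \<and> x \<in> U \<and> (\<forall>y\<in>U. N (f y \<ominus> f x) < e)"
    if x: "x \<in> topspace X" and e: "e > 0" for x e
  proof -
    obtain U where U: "openin X U" "x \<in> U" "\<forall>y\<in>U. f y \<in> M.mball (f x) e"
      using L x e unfolding norm_topology_def M.continuous_map_to_metric by meson
    have "N (f y \<ominus> f x) < e" if "y \<in> U" for y
    proof -
      have "f y \<in> carrier R" "norm_dist R N (f x) (f y) < e" using U(3) that by auto
      then show ?thesis using R0[OF x] norm_minus_swap[of "f x"] by (simp add: norm_dist_eq)
    qed
    then show ?thesis using U by blast
  qed
  then show ?R using R0 by blast
next
  assume R: ?R
  show ?L
    unfolding norm_topology_def M.continuous_map_to_metric
  proof (intro ballI allI impI)
    fix x and e :: real assume x: "x \<in> topspace X" and "e > 0"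
    then obtain U where "openin X U" "x \<in> U" "\<forall>y\<in>U. N (f y \<ominus> f x) < e" using R by blast
    moreover have "f y \<in> M.mball (f x) e" if "y \<in> topspace X" "N (f y \<ominus> f x) < e" for y
      using R x that norm_minus_swap[of "f x" "f y"] by (simp add: norm_dist_eq)
    ultimately show "\<exists>U. openin X U \<and> x \<in> U \<and> (\<forall>y\<in>U. f y \<in> M.mball (f x) e)"
      using openin_subset[of X U] by blast
  qed
qed

lemma continuous_map_carrier:
  "continuous_map X (norm_topology R N) f \<Longrightarrow> x \<in> topspace X \<Longrightarrow> f x \<in> carrier R"
  by (simp add: continuous_map_norm_topology_iff)

lemma continuous_map_const_norm: "c \<in> carrier R \<Longrightarrow> continuous_map X (norm_topology R N) (\<lambda>_. c)"
  by (simp add: topspace_norm_topology)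

lemma continuous_map_normI:
  assumes "\<And>x. x \<in> topspace X \<Longrightarrow> u x \<in> carrier R"
    and "\<And>x e. x \<in> topspace X \<Longrightarrow> e > 0 \<Longrightarrow>
      \<exists>U. openin X U \<and> x \<in> U \<and> (\<forall>y\<in>U. N (u y \<ominus> u x) < e)"
  shows "continuous_map X (norm_topology R N) u"
  using assms by (simp add: continuous_map_norm_topology_iff)

lemma continuous_map_normD:
  assumes "continuous_map X (norm_topology R N) u" "x \<in> topspace X" "e > 0"
  obtains U where "openin X U" "x \<in> U" "\<And>y. y \<in> U \<Longrightarrow> N (u y \<ominus> u x) < e"
  using assms unfolding continuous_map_norm_topology_iff by meson

lemma continuous_map_neg:
  assumes f: "continuous_map X (norm_topology R N) f"
  shows "continuous_map X (norm_topology R N) (\<lambda>x. \<ominus> f x)"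
proof (rule continuous_map_normI)
  note c = continuous_map_carrier[OF f]
  show "\<ominus> f x \<in> carrier R" if "x \<in> topspace X" for x using c[OF that] by simp
  fix x and e :: real assume x: "x \<in> topspace X" and e: "e > 0"
  obtain U where U: "openin X U" "x \<in> U" "\<And>y. y \<in> U \<Longrightarrow> N (f y \<ominus> f x) < e"
    using continuous_map_normD[OF f x e] by blast
  have "N (\<ominus> f y \<ominus> \<ominus> f x) < e" if "y \<in> U" for y
  proof -
    have "y \<in> topspace X" using U that openin_subset by blast
    then have "\<ominus> f y \<ominus> \<ominus> f x = \<ominus> (f y \<ominus> f x)" using c x by algebra
    then show ?thesis using U(3)[OF that] norm_neg c x \<open>y \<in> topspace X\<close> by simp
  qed
  then show "\<exists>U. openin X U \<and> x \<in> U \<and> (\<forall>y\<in>U. N (\<ominus> f y \<ominus> \<ominus> f x) < e)" using U by blast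
qed

lemma continuous_map_add_norm:
  assumes f: "continuous_map X (norm_topology R N) f" and g: "continuous_map X (norm_topology R N) g"
  shows "continuous_map X (norm_topology R N) (\<lambda>x. f x \<oplus> g x)"
proof (rule continuous_map_normI)
  note c = continuous_map_carrier[OF f] continuous_map_carrier[OF g]
  show "f x \<oplus> g x \<in> carrier R" if "x \<in> topspace X" for x using c[OF that] by simp
  fix x and e :: real assume x: "x \<in> topspace X" and e: "e > 0"
  obtain U where U: "openin X U" "x \<in> U" "\<And>y. y \<in> U \<Longrightarrow> N (f y \<ominus> f x) < e/2"
    using continuous_map_normD[OF f x, of "e/2"] e by auto
  obtain V where V: "openin X V" "x \<in> V" "\<And>y. y \<in> V \<Longrightarrow> N (g y \<ominus> g x) < e/2"
    using continuous_map_normD[OF g x, of "e/2"] e by auto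
  have "N ((f y \<oplus> g y) \<ominus> (f x \<oplus> g x)) < e" if y: "y \<in> U \<inter> V" for y
  proof -
    have yX: "y \<in> topspace X" using U y openin_subset by blast
    then have "(f y \<oplus> g y) \<ominus> (f x \<oplus> g x) = (f y \<ominus> f x) \<oplus> (g y \<ominus> g x)" using c x by algebra
    then have "N ((f y \<oplus> g y) \<ominus> (f x \<oplus> g x)) \<le> N (f y \<ominus> f x) + N (g y \<ominus> g x)"
      using c x yX norm_add by simp
    also have "\<dots> < e" using U(3)[of y] V(3)[of y] y by simp
    finally show ?thesis .
  qed
  then show "\<exists>W. openin X W \<and> x \<in> W \<and> (\<forall>y\<in>W. N ((f y \<oplus> g y) \<ominus> (f x \<oplus> g x)) < e)"
    using U V by (intro exI[of _ "U \<inter> V"]) auto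
qed

lemma continuous_map_mult_norm:
  assumes f: "continuous_map X (norm_topology R N) f" and g: "continuous_map X (norm_topology R N) g"
  shows "continuous_map X (norm_topology R N) (\<lambda>x. f x \<otimes> g x)"
proof (rule continuous_map_normI)
  note c = continuous_map_carrier[OF f] continuous_map_carrier[OF g]
  obtain C where C: "0 \<le> C"
    "\<And>x y. x \<in> carrier R \<Longrightarrow> y \<in> carrier R \<Longrightarrow> N (x \<otimes> y) \<le> C * N x * N y"
    using norm_mult by blast
  show "f x \<otimes> g x \<in> carrier R" if "x \<in> topspace X" for x using c[OF that] by simp
  fix x and e :: real assume x: "x \<in> topspace X" and e: "e > 0"
  \<comment> \<open>With \<open>p\<close> and \<open>q\<close> the increments, the difference of
    products is \<open>p \<otimes> q \<oplus> (p \<otimes> g x \<oplus> f x \<otimes> q)\<close>.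
    The inner 1 in \<open>K\<close> accounts for \<open>p \<otimes> q\<close>, as
    \<open>N q < 1\<close>; the outer 1 makes \<open>K\<close> positive and the final inequality
    strict.\<close>
  define K where "K = C * (N (f x) + N (g x) + 1) + 1"
  have K: "K > 0" using C(1) norm_nonneg c x by (simp add: K_def add_nonneg_pos)
  define d where "d = min 1 (e / K)"
  have d: "d > 0" "d \<le> 1" "d * K \<le> e" using e K by (auto simp: d_def min_def field_simps)
  obtain U where U: "openin X U" "x \<in> U" "\<And>y. y \<in> U \<Longrightarrow> N (f y \<ominus> f x) < d"
    using continuous_map_normD[OF f x d(1)] by blast
  obtain V where V: "openin X V" "x \<in> V" "\<And>y. y \<in> V \<Longrightarrow> N (g y \<ominus> g x) < d"
    using continuous_map_normD[OF g x d(1)] by blast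
  have "N (f y \<otimes> g y \<ominus> f x \<otimes> g x) < e" if y: "y \<in> U \<inter> V" for y
  proof -
    have yX: "y \<in> topspace X" using U y openin_subset by blast
    note cc = c[OF x] c[OF yX]
    define p q where "p = f y \<ominus> f x" and "q = g y \<ominus> g x"
    have pq: "p \<in> carrier R" "q \<in> carrier R" "N p < d" "N q < d"
      using cc U(3)[of y] V(3)[of y] y by (auto simp: p_def q_def)
    have "f y \<otimes> g y \<ominus> f x \<otimes> g x = p \<otimes> q \<oplus> (p \<otimes> g x \<oplus> f x \<otimes> q)"
      unfolding p_def q_def using cc by algebra
    then have "N (f y \<otimes> g y \<ominus> f x \<otimes> g x) \<le> N (p \<otimes> q) + (N (p \<otimes> g x) + N (f x \<otimes> q))"
      using cc pq norm_add[of "p \<otimes> q" "p \<otimes> g x \<oplus> f x \<otimes> q"] norm_add[of "p \<otimes> g x" "f x \<otimes> q"]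
      by simp
    also have "\<dots> \<le> C * N p * N q + (C * N p * N (g x) + C * N (f x) * N q)"
      using cc pq by (intro add_mono C)
    also have "\<dots> \<le> C * d * 1 + (C * d * N (g x) + C * N (f x) * d)"
      using cc pq C(1) d norm_nonneg
      by (intro add_mono mult_mono) (auto intro!: mult_nonneg_nonneg order_less_imp_le)
    also have "\<dots> = d * (K - 1)" by (simp add: K_def algebra_simps)
    also have "\<dots> < e" using d by (simp add: algebra_simps)
    finally show ?thesis .
  qed
  then show "\<exists>W. openin X W \<and> x \<in> W \<and> (\<forall>y\<in>W. N (f y \<otimes> g y \<ominus> f x \<otimes> g x) < e)"
    using U V by (intro exI[of _ "U \<inter> V"]) auto
qed

lemma continuous_map_diff_norm:
  assumes "continuous_map X (norm_topology R N) f" "continuous_map X (norm_topology R N) g"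
  shows "continuous_map X (norm_topology R N) (\<lambda>x. f x \<ominus> g x)"
  using continuous_map_add_norm[OF assms(1) continuous_map_neg[OF assms(2)]] by (simp add: minus_eq)

text \<open>Here \<open>\<phi>\<close> is a modulus of continuity. It is applied with a linear
  modulus to norms and with a fractional power to an isomorphism onto the reals. Only distinct
  points are compared, which fits a limit taken at positive arguments.\<close>

lemma continuous_map_real_if_norm_bound:
  fixes v :: "'a \<Rightarrow> real"
  assumes phi: "(\<phi> \<longlongrightarrow> 0) (at_right 0)"
    and v: "\<And>x y. x \<in> carrier R \<Longrightarrow> y \<in> carrier R \<Longrightarrow> x \<noteq> y \<Longrightarrow> \<bar>v y - v x\<bar> \<le> \<phi> (N (y \<ominus> x))"
  shows "continuous_map (norm_topology R N) euclideanreal v"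
  unfolding mtopology_is_euclidean[symmetric] Met_TC.continuous_map_to_metric
proof (intro ballI allI impI)
  fix x and e :: real assume x: "x \<in> topspace (norm_topology R N)" and e: "e > 0"
  have xR: "x \<in> carrier R" using x by (simp add: topspace_norm_topology)
  have "\<forall>\<^sub>F t in at_right 0. \<phi> t < e" using order_tendstoD(2)[OF phi e] .
  then obtain d where d: "d > 0" "\<And>t. 0 < t \<Longrightarrow> t < d \<Longrightarrow> \<phi> t < e"
    by (auto simp: eventually_at_right_field)
  show "\<exists>U. openin (norm_topology R N) U \<and> x \<in> U \<and> (\<forall>y\<in>U. v y \<in> Met_TC.mball (v x) e)"
  proof (intro exI[of _ "M.mball x d"] conjI ballI)
    show "openin (norm_topology R N) (M.mball x d)" by (simp add: norm_topology_def)
    show "x \<in> M.mball x d" using d xR by simp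
    fix y assume y: "y \<in> M.mball x d"
    then have yR: "y \<in> carrier R" and lt: "N (y \<ominus> x) < d"
      using xR by (auto simp: norm_dist_eq norm_minus_swap[of x])
    have "\<bar>v y - v x\<bar> < e"
    proof (cases "x = y")
      case False
      then have "N (y \<ominus> x) > 0"
        using norm_nonneg[of "y \<ominus> x"] norm_zero_iff[of "y \<ominus> x"] xR yR
        by (metis minus_closed order_less_le r_right_minus_eq)
      then show ?thesis using d(2)[OF _ lt] v[OF xR yR False] by simp
    qed (use e in simp)
    then show "v y \<in> Met_TC.mball (v x) e" by (simp add: dist_real_def abs_minus_commute)
  qed
qed

lemma continuous_map_norm: "continuous_map (norm_topology R N) euclideanreal N"
proof (rule continuous_map_real_if_norm_bound[where \<phi> = "\<lambda>t. t"])
  fix x y assume xy: "x \<in> carrier R" "y \<in> carrier R"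
  have e: "(y \<ominus> x) \<oplus> x = y" "(x \<ominus> y) \<oplus> y = x" using xy by algebra+
  have "N y \<le> N (y \<ominus> x) + N x" "N x \<le> N (x \<ominus> y) + N y"
    using norm_add[of "y \<ominus> x" x] norm_add[of "x \<ominus> y" y] xy by (simp_all only: e minus_closed)
  then show "\<bar>N y - N x\<bar> \<le> N (y \<ominus> x)" using norm_minus_swap[OF xy] by simp
qed simp

end

section \<open>Multiplicative ultrametric norms\<close>

text \<open>The norm \<open>N\<close> supplies the topology, while \<open>v\<close> measures the
  approximation. Neither norm is required to bound the other here: continuity of \<open>v\<close> is
  the only link.\<close>

locale ultrametric_domain = normed_cring R N + domain R for R (structure) and N +
  fixes v :: "'a \<Rightarrow> real"
  assumes v_continuous: "continuous_map (norm_topology R N) euclideanreal v"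
    and v_nonneg: "x \<in> carrier R \<Longrightarrow> 0 \<le> v x"
    and v_zero_iff: "x \<in> carrier R \<Longrightarrow> v x = 0 \<longleftrightarrow> x = \<zero>"
    and v_mult: "x \<in> carrier R \<Longrightarrow> y \<in> carrier R \<Longrightarrow> v (x \<otimes> y) = v x * v y"
    and v_add: "x \<in> carrier R \<Longrightarrow> y \<in> carrier R \<Longrightarrow> v (x \<oplus> y) \<le> max (v x) (v y)"
begin

lemma v_zero: "v \<zero> = 0"
  by (simp add: v_zero_iff)

lemma v_self_diff: "x \<in> carrier R \<Longrightarrow> v (x \<ominus> x) = 0"
  by (simp add: v_zero_iff)

lemma v_pos: "x \<in> carrier R \<Longrightarrow> x \<noteq> \<zero> \<Longrightarrow> 0 < v x"
  using v_nonneg[of x] v_zero_iff[of x] by auto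

lemma v_one: "v \<one> = 1"
  using v_mult[of \<one> \<one>] v_pos[of \<one>] by simp

lemma v_neg: "x \<in> carrier R \<Longrightarrow> v (\<ominus> x) = v x"
proof -
  assume x: "x \<in> carrier R"
  have "(\<ominus> \<one>) \<otimes> (\<ominus> \<one>) = \<one>" by algebra
  then have "v (\<ominus> \<one>) * v (\<ominus> \<one>) = 1" using v_mult[of "\<ominus> \<one>" "\<ominus> \<one>"] v_one by simp
  then have "v (\<ominus> \<one>) = 1" using v_nonneg[of "\<ominus> \<one>"] by (simp add: square_eq_1_iff)
  moreover have "\<ominus> x = (\<ominus> \<one>) \<otimes> x" using x by algebra
  ultimately show ?thesis using v_mult[of "\<ominus> \<one>" x] x by simp
qed

lemma v_diff: "x \<in> carrier R \<Longrightarrow> y \<in> carrier R \<Longrightarrow> v (x \<ominus> y) \<le> max (v x) (v y)"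
  using v_add[of x "\<ominus> y"] by (simp add: minus_eq v_neg)

lemma v_pow: "x \<in> carrier R \<Longrightarrow> v (x [^] (n::nat)) = v x ^ n"
  by (induction n) (simp_all add: v_one v_mult)

text \<open>The relative distance \<open>\<delta>\<close> survives taking powers, without a factor
  \<open>n\<close>: in the telescoping identity each term obeys the same bound, and the ultrametric
  inequality takes their maximum instead of their sum.\<close>

lemma v_pow_diff:
  assumes ab: "a \<in> carrier R" "b \<in> carrier R"
    and "v (a \<ominus> b) \<le> \<delta> * v a" "v b \<le> v a" "0 \<le> \<delta>"
  shows "v (a [^] (n::nat) \<ominus> b [^] n) \<le> \<delta> * v a ^ n"
proof (induction n)
  case 0
  show ?case using assms by (simp add: v_self_diff)
next
  case (Suc n)
  have car: "a [^] n \<in> carrier R" "b [^] n \<in> carrier R" using ab by auto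
  have "a [^] Suc n \<ominus> b [^] Suc n = a [^] n \<otimes> (a \<ominus> b) \<oplus> (a [^] n \<ominus> b [^] n) \<otimes> b"
    unfolding nat_pow_Suc using ab car by algebra
  then have "v (a [^] Suc n \<ominus> b [^] Suc n)
      \<le> max (v a ^ n * v (a \<ominus> b)) (v (a [^] n \<ominus> b [^] n) * v b)"
    using v_add[of "a [^] n \<otimes> (a \<ominus> b)" "(a [^] n \<ominus> b [^] n) \<otimes> b"] ab car
    by (simp add: v_mult v_pow)
  also have "\<dots> \<le> \<delta> * v a ^ Suc n"
  proof (rule max.boundedI)
    have "v a ^ n * v (a \<ominus> b) \<le> v a ^ n * (\<delta> * v a)"
      using assms v_nonneg by (intro mult_left_mono) auto
    then show "v a ^ n * v (a \<ominus> b) \<le> \<delta> * v a ^ Suc n" by (simp add: algebra_simps)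
    have "v (a [^] n \<ominus> b [^] n) * v b \<le> (\<delta> * v a ^ n) * v a"
      using assms v_nonneg Suc by (intro mult_mono) auto
    then show "v (a [^] n \<ominus> b [^] n) * v b \<le> \<delta> * v a ^ Suc n" by (simp add: algebra_simps)
  qed
  finally show ?case .
qed

lemma continuous_map_v:
  "continuous_map X (norm_topology R N) u \<Longrightarrow> continuous_map X euclideanreal (\<lambda>x. v (u x))"
  using continuous_map_compose[of X "norm_topology R N" u euclideanreal v] v_continuous
  by (simp add: o_def)

text \<open>A perturbation of size below \<open>M\<close> cannot bring a value of size at least
  \<open>M\<close> below \<open>M\<close>, by the ultrametric inequality. So the strict sublevel set
  is closed as well as open, and gluing can split a closed set into two disjoint closed
  pieces.\<close>

lemma closedin_v_less:
  assumes u: "continuous_map X (norm_topology R N) u" and M: "M > 0"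
  shows "closedin X {x \<in> topspace X. v (u x) < M}"
proof -
  have "openin X {x \<in> topspace X. M \<le> v (u x)}"
  proof (subst openin_subopen, intro ballI)
    fix x assume x: "x \<in> {x \<in> topspace X. M \<le> v (u x)}"
    then have ux: "u x \<in> carrier R" using continuous_map_carrier[OF u] by auto
    let ?V = "{y \<in> topspace X. v (u x \<ominus> u y) < M}"
    have "openin X ?V"
      by (intro openin_less_continuous_map continuous_map_v continuous_map_diff_norm
          continuous_map_const_norm u ux)
    moreover have "x \<in> ?V" using x ux M by (simp add: v_self_diff)
    moreover have "M \<le> v (u y)" if "y \<in> ?V" for y
    proof -
      have uy: "u y \<in> carrier R" using that continuous_map_carrier[OF u] by auto
      have "u x = (u x \<ominus> u y) \<oplus> u y" using ux uy by algebra
      then have "v (u x) \<le> max (v (u x \<ominus> u y)) (v (u y))"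
        using v_add[of "u x \<ominus> u y" "u y"] ux uy by simp
      then show ?thesis using that x by auto
    qed
    ultimately show "\<exists>T. openin X T \<and> x \<in> T \<and> T \<subseteq> {x \<in> topspace X. M \<le> v (u x)}"
      by (intro exI[of _ ?V]) auto
  qed
  then have "closedin X (topspace X - {x \<in> topspace X. M \<le> v (u x)})" by blast
  moreover have "topspace X - {x \<in> topspace X. M \<le> v (u x)} = {x \<in> topspace X. v (u x) < M}"
    by auto
  ultimately show ?thesis by simp
qed

end

text \<open>Elements of \<open>D\<close> are total functions, so that sums and products are plain
  lambda terms. Values off the space are arbitrary there, and \<open>D_cong\<close> says that they
  do not affect membership.\<close>

locale ultrametric_function_algebra = ultrametric_domain R N v for R (structure) and N v +
  fixes X :: "'x topology" and D :: "('x \<Rightarrow> 'a) set"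
  assumes compact: "compact_space X"
    and D_cont: "g \<in> D \<Longrightarrow> continuous_map X (norm_topology R N) g"
    and D_const: "c \<in> carrier R \<Longrightarrow> (\<lambda>_. c) \<in> D"
    and D_add: "g \<in> D \<Longrightarrow> h \<in> D \<Longrightarrow> (\<lambda>x. g x \<oplus> h x) \<in> D"
    and D_mult: "g \<in> D \<Longrightarrow> h \<in> D \<Longrightarrow> (\<lambda>x. g x \<otimes> h x) \<in> D"
    and D_cong: "g \<in> D \<Longrightarrow> (\<And>x. x \<in> topspace X \<Longrightarrow> g x = h x) \<Longrightarrow> h \<in> D"
    and D_sep: "separates_points X D"
begin

lemma D_carrier: "g \<in> D \<Longrightarrow> x \<in> topspace X \<Longrightarrow> g x \<in> carrier R"
  using continuous_map_carrier[OF D_cont] .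

lemma D_diff:
  assumes "g \<in> D" "h \<in> D"
  shows "(\<lambda>x. g x \<ominus> h x) \<in> D"
proof (rule D_cong)
  \<comment> \<open>The rewriting into a difference is valid only for values in the carrier, hence
    only on the space; \<open>D_cong\<close> bridges this.\<close>
  show "(\<lambda>x. g x \<oplus> (\<ominus> \<one>) \<otimes> h x) \<in> D" using assms by (intro D_add D_mult D_const) auto
  show "g x \<oplus> (\<ominus> \<one>) \<otimes> h x = g x \<ominus> h x" if "x \<in> topspace X" for x
    using D_carrier[OF assms(1) that] D_carrier[OF assms(2) that] by algebra
qed

lemma D_pow: "g \<in> D \<Longrightarrow> (\<lambda>x. g x [^] (n::nat)) \<in> D"
proof (induction n)
  case 0 then show ?case using D_const[of \<one>] by simp
next
  case (Suc n) then show ?case using D_mult[of "\<lambda>x. g x [^] n" g] by simp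
qed

text \<open>By compactness, finitely many values \<open>h y\<close> of size \<open>M\<close>
  represent, up to errors below \<open>M\<close>, all values of that size on \<open>S\<close>. Take
  for \<open>p\<close> the product of the factors \<open>h y \<ominus> h x\<close> and for
  \<open>q\<close> the product of the \<open>h y\<close>. Where \<open>v (h x) = M\<close>, some
  factor of \<open>p\<close> is smaller than \<open>M\<close>; where \<open>v (h x) < M\<close>,
  each factor differs from its \<open>h y\<close> by less than \<open>M\<close>. Dividing
  \<open>p\<close> by \<open>q\<close> would give a function congruent to 1 on one set and to 0 on
  the other.\<close>

lemma weak_separation:
  assumes S: "closedin X S" and h: "h \<in> D" and M: "M > 0" and le: "\<And>x. x \<in> S \<Longrightarrow> v (h x) \<le> M"
  obtains p q where "p \<in> D" "q \<in> carrier R" "q \<noteq> \<zero>"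
    "\<And>x. x \<in> S \<Longrightarrow> v (h x) < M \<Longrightarrow> v (q \<ominus> p x) < v q"
    "\<And>x. x \<in> S \<Longrightarrow> v (h x) = M \<Longrightarrow> v (p x) < v q"
proof -
  have SX: "S \<subseteq> topspace X" using S by (rule closedin_subset)
  have hR: "h x \<in> carrier R" if "x \<in> S" for x using D_carrier[OF h] SX that by auto
  define S2 where "S2 = S \<inter> {x \<in> topspace X. M \<le> v (h x)}"
  define U where "U y = {x \<in> topspace X. v (h y \<ominus> h x) < M}" for y
  have S2: "y \<in> S2 \<longleftrightarrow> y \<in> S \<and> v (h y) = M" for y using le[of y] SX by (auto simp: S2_def)
  have opU: "openin X (U y)" if "y \<in> S" for y
    unfolding U_def
    by (intro openin_less_continuous_map continuous_map_v continuous_map_diff_norm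
          continuous_map_const_norm D_cont h hR that)
  have "compactin X S2"
    unfolding S2_def
    by (intro closedin_compact_space[OF compact] closedin_Int S closedin_le_continuous_map
        continuous_map_v D_cont h)
  moreover have "y \<in> U y" if "y \<in> S" for y
  proof -
    show ?thesis using M that SX hR[OF that] by (auto simp: U_def v_self_diff)
  qed
  then have "S2 \<subseteq> \<Union> (U ` S2)" using S2 by auto
  moreover have "openin X V" if "V \<in> U ` S2" for V using opU that S2 by auto
  ultimately obtain \<F> where \<F>: "finite \<F>" "\<F> \<subseteq> U ` S2" "S2 \<subseteq> \<Union>\<F>"
    using compactinD[of X S2 "U ` S2"] by meson
  obtain F where F: "F \<subseteq> S2" "finite F" "\<F> = U ` F" using finite_subset_image[OF \<F>(1,2)] by blast
  \<comment> \<open>The bound \<open>v (p x) \<le> v q\<close> on all of \<open>S\<close> is carried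
    through the induction so that the remaining factors never outweigh a single small one.\<close>
  have "\<exists>p\<in>D. \<exists>q\<in>carrier R - {\<zero>}. (\<forall>x\<in>S. v (p x) \<le> v q \<and>
      (v (h x) < M \<longrightarrow> v (q \<ominus> p x) < v q) \<and> (x \<in> \<Union> (U ` F) \<longrightarrow> v (p x) < v q))"
    using F(2,1)
  proof (induction F rule: finite_induct)
    case empty
    show ?case
      by (intro bexI[of _ "\<lambda>_. \<one>"] bexI[of _ \<one>]) (auto simp: D_const v_one v_self_diff)
  next
    case (insert y F)
    then obtain p q where p: "p \<in> D" and q: "q \<in> carrier R" "q \<noteq> \<zero>"
      and p1: "\<And>x. x \<in> S \<Longrightarrow> v (p x) \<le> v q"
      and p2: "\<And>x. x \<in> S \<Longrightarrow> v (h x) < M \<Longrightarrow> v (q \<ominus> p x) < v q"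
      and p3: "\<And>x. x \<in> S \<Longrightarrow> x \<in> \<Union> (U ` F) \<Longrightarrow> v (p x) < v q"
      by auto
    have y: "y \<in> S" "v (h y) = M" using insert.prems S2 by auto
    note yR = hR[OF y(1)]
    have q0: "v q > 0" using v_pos q by blast
    let ?p = "\<lambda>x. p x \<otimes> (h y \<ominus> h x)" and ?q = "q \<otimes> h y"
    have vq: "v ?q = v q * M" using q yR y by (simp add: v_mult)
    have main: "v (?p x) \<le> v ?q \<and> (v (h x) < M \<longrightarrow> v (?q \<ominus> ?p x) < v ?q) \<and>
        (x \<in> \<Union> (U ` insert y F) \<longrightarrow> v (?p x) < v ?q)" if x: "x \<in> S" for x
    proof -
      have xR: "h x \<in> carrier R" "p x \<in> carrier R" using hR x D_carrier[OF p] SX by auto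
      have vp: "v (?p x) = v (p x) * v (h y \<ominus> h x)" using xR yR by (simp add: v_mult)
      have leM: "v (h y \<ominus> h x) \<le> M" using v_diff[OF yR xR(1)] y(2) le[OF x] by simp
      have "v (?p x) \<le> v ?q"
        unfolding vp vq using p1[OF x] leM xR yR q by (intro mult_mono v_nonneg) auto
      moreover have "v (?q \<ominus> ?p x) < v ?q" if lt: "v (h x) < M"
      proof -
        \<comment> \<open>The first summand is small by the induction hypothesis, the second because
          \<open>h x\<close> itself is below \<open>M\<close>.\<close>
        have "?q \<ominus> ?p x = (q \<ominus> p x) \<otimes> h y \<oplus> p x \<otimes> h x" using xR yR q by algebra
        then have "v (?q \<ominus> ?p x) \<le> max (v (q \<ominus> p x) * M) (v (p x) * v (h x))"
          using v_add[of "(q \<ominus> p x) \<otimes> h y" "p x \<otimes> h x"] xR yR q y(2) by (simp add: v_mult)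
        moreover have "v (q \<ominus> p x) * M < v q * M" using p2[OF x lt] M by simp
        moreover have "v (p x) * v (h x) < v q * M"
          using mult_mono[OF p1[OF x] order_refl] lt q0 v_nonneg[OF xR(1)]
          by (smt (verit) mult_strict_left_mono)
        ultimately show ?thesis unfolding vq by simp
      qed
      moreover have "v (?p x) < v ?q" if "x \<in> \<Union> (U ` insert y F)"
      proof (cases "x \<in> U y")
        case True
        then have "v (h y \<ominus> h x) < M" by (simp add: U_def)
        then have "v (p x) * v (h y \<ominus> h x) \<le> v q * v (h y \<ominus> h x)" "v q * v (h y \<ominus> h x) < v q * M"
          using p1[OF x] q0 v_nonneg[of "h y \<ominus> h x"] xR yR by (auto intro: mult_right_mono)
        then show ?thesis unfolding vp vq by linarith
      next
        case False
        then have "v (p x) < v q" using p3[OF x] that by auto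
        then have "v (p x) * M < v q * M" "v (p x) * v (h y \<ominus> h x) \<le> v (p x) * M"
          using M leM v_nonneg[OF xR(2)] by (auto intro: mult_left_mono)
        then show ?thesis unfolding vp vq by linarith
      qed
      ultimately show ?thesis by blast
    qed
    have "?p \<in> D" by (intro D_mult D_diff D_const p h yR)
    moreover have "?q \<in> carrier R - {\<zero>}"
      using q yR y(2) M v_zero by (auto simp: integral_iff)
    ultimately show ?case
      by (intro bexI[of _ ?p] bexI[of _ ?q] ballI main)
  qed
  then obtain p q where pq: "p \<in> D" "q \<in> carrier R" "q \<noteq> \<zero>" and *: "\<forall>x\<in>S. v (p x) \<le> v q \<and>
      (v (h x) < M \<longrightarrow> v (q \<ominus> p x) < v q) \<and> (x \<in> \<Union> (U ` F) \<longrightarrow> v (p x) < v q)"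
    by auto
  have "x \<in> \<Union> (U ` F)" if "x \<in> S" "v (h x) = M" for x
    using that S2 \<F>(3) F(3) by blast
  then show thesis using * by (intro that[OF pq]) auto
qed

text \<open>Writing \<open>Q = q\<^sup>n\<close> and \<open>P = p\<^sup>n\<close>, the function \<open>Q\<^sup>n - (Q - P)\<^sup>n\<close> is close to \<open>Q\<^sup>n\<close> where
  \<open>p\<close> is close to \<open>q\<close>, and small where \<open>p\<close> is small.\<close>

lemma strong_separation:
  assumes S: "closedin X S" and h: "h \<in> D" and M: "M > 0" and le: "\<And>x. x \<in> S \<Longrightarrow> v (h x) \<le> M"
    and \<eta>: "\<eta> > 0"
  obtains e a where "e \<in> D" "a \<in> carrier R" "a \<noteq> \<zero>"
    "\<And>x. x \<in> S \<Longrightarrow> v (e x) \<le> v a" "\<And>x. x \<in> S \<Longrightarrow> v (a \<ominus> e x) \<le> v a"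
    "\<And>x. x \<in> S \<Longrightarrow> v (h x) < M \<Longrightarrow> v (a \<ominus> e x) \<le> \<eta> * v a"
    "\<And>x. x \<in> S \<Longrightarrow> v (h x) = M \<Longrightarrow> v (e x) \<le> \<eta> * v a"
proof -
  have SX: "S \<subseteq> topspace X" using S by (rule closedin_subset)
  obtain p q where p: "p \<in> D" and q: "q \<in> carrier R" "q \<noteq> \<zero>"
    and p1: "\<And>x. x \<in> S \<Longrightarrow> v (h x) < M \<Longrightarrow> v (q \<ominus> p x) < v q"
    and p2: "\<And>x. x \<in> S \<Longrightarrow> v (h x) = M \<Longrightarrow> v (p x) < v q"
    using weak_separation[OF S h M le] by blast
  have q0: "v q > 0" using v_pos q by blast
  define S1 where "S1 = S \<inter> {x \<in> topspace X. v (h x) < M}"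
  define S2 where "S2 = S \<inter> {x \<in> topspace X. M \<le> v (h x)}"
  have S1: "x \<in> S1 \<longleftrightarrow> x \<in> S \<and> v (h x) < M" for x using SX by (auto simp: S1_def)
  have S2: "x \<in> S2 \<longleftrightarrow> x \<in> S \<and> v (h x) = M" for x using le[of x] SX by (auto simp: S2_def)
  have co: "compactin X S1" "compactin X S2"
    unfolding S1_def S2_def
    by (intro closedin_compact_space[OF compact] closedin_Int S closedin_v_less[OF D_cont[OF h] M]
        closedin_le_continuous_map continuous_map_v D_cont h)+
  have "continuous_map X euclideanreal (\<lambda>x. v (q \<ominus> p x))"
    by (intro continuous_map_v continuous_map_diff_norm continuous_map_const_norm D_cont p q)
  then obtain d1 where d1: "d1 < v q" "\<And>x. x \<in> S1 \<Longrightarrow> v (q \<ominus> p x) \<le> d1"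
    using compactin_uniform_less[OF co(1), of "\<lambda>x. v (q \<ominus> p x)" "v q"] p1 S1 by blast
  obtain d2 where d2: "d2 < v q" "\<And>x. x \<in> S2 \<Longrightarrow> v (p x) \<le> d2"
    using compactin_uniform_less[OF co(2) continuous_map_v[OF D_cont[OF p]], of "v q"] p2 S2 by blast
  \<comment> \<open>One ratio below 1 serves both sets. The maximum with 0 is needed because
    \<open>d1\<close> or \<open>d2\<close> can be negative when \<open>S1\<close> or
    \<open>S2\<close> is empty.\<close>
  define \<delta> where "\<delta> = max 0 (max d1 d2) / v q"
  have \<delta>: "0 \<le> \<delta>" "\<delta> < 1" "d1 \<le> \<delta> * v q" "d2 \<le> \<delta> * v q"
    using d1(1) d2(1) q0 by (auto simp: \<delta>_def)
  have "(\<lambda>n. \<delta> ^ n) \<longlonglongrightarrow> 0" using \<delta> by (intro LIMSEQ_power_zero) auto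
  then have "\<forall>\<^sub>F n in sequentially. \<delta> ^ n < \<eta>" using \<eta> by (rule order_tendstoD)
  then obtain n0 where "\<And>n. n \<ge> n0 \<Longrightarrow> \<delta> ^ n < \<eta>" by (auto simp: eventually_sequentially)
  then have n0: "\<delta> ^ Suc n0 < \<eta>" by (meson le_Suc_eq order_refl)
  define n where "n = Suc n0"
  have n: "\<delta> ^ n < \<eta>" "\<delta> ^ n \<le> \<delta>"
    using n0 \<delta> power_le_one[of \<delta> n0] by (auto simp: n_def mult_left_le)
  \<comment> \<open>Each power has its own task. The inner one shrinks \<open>P\<close> relative to
    \<open>Q\<close> on \<open>S2\<close>; the outer one shrinks \<open>Q \<ominus> P x\<close>,
    which on \<open>S1\<close> is only known to be within the factor \<open>\<delta>\<close> of
    \<open>Q\<close>.\<close>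
  define Q where "Q = q [^] n"
  define P where "P = (\<lambda>x. p x [^] n)"
  define a where "a = Q [^] n"
  define e where "e = (\<lambda>x. a \<ominus> (Q \<ominus> P x) [^] n)"
  have QR: "Q \<in> carrier R" "a \<in> carrier R" using q by (auto simp: Q_def a_def)
  have vQ: "v Q = v q ^ n" "v a = v Q ^ n" using q QR by (simp_all add: Q_def a_def v_pow)
  have Q0: "v Q > 0" "v a > 0" using q0 by (simp_all add: vQ)
  have PD: "P \<in> D" unfolding P_def by (intro D_pow p)
  have eD: "e \<in> D" unfolding e_def by (intro D_diff D_pow D_const PD QR)
  have part1: "v (a \<ominus> e x) \<le> \<delta> ^ n * v a" "v (e x) \<le> v a" if x: "x \<in> S1" for x
  proof -
    have xR: "p x \<in> carrier R" "P x \<in> carrier R" "e x \<in> carrier R"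
      using x S1 SX D_carrier[OF p] D_carrier[OF PD] D_carrier[OF eD] by auto
    have le: "v (q \<ominus> p x) \<le> \<delta> * v q" using d1(2)[OF x] \<delta>(3) by linarith
    have "p x = q \<ominus> (q \<ominus> p x)" using xR q by algebra
    then have "v (p x) \<le> max (v q) (v (q \<ominus> p x))" using v_diff[of q "q \<ominus> p x"] xR q by simp
    then have "v (p x) \<le> v q" using p1[of x] x S1 by auto
    then have "v (Q \<ominus> P x) \<le> \<delta> * v q ^ n"
      unfolding Q_def P_def using v_pow_diff[OF q(1) xR(1) le _ \<delta>(1)] by blast
    then have "v (Q \<ominus> P x) ^ n \<le> (\<delta> * v Q) ^ n"
      unfolding vQ(1) using xR QR by (intro power_mono v_nonneg) auto
    moreover have "a \<ominus> e x = (Q \<ominus> P x) [^] n"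
    proof -
      have "(Q \<ominus> P x) [^] n \<in> carrier R" using xR QR by simp
      then show ?thesis unfolding e_def using QR(2) by algebra
    qed
    ultimately show 1: "v (a \<ominus> e x) \<le> \<delta> ^ n * v a"
      using xR QR by (simp add: v_pow vQ(2) power_mult_distrib)
    have "\<delta> ^ n * v a \<le> 1 * v a" using \<delta> Q0 by (intro mult_right_mono power_le_one) auto
    moreover have "e x = a \<ominus> (a \<ominus> e x)" using xR QR by algebra
    then have "v (e x) \<le> max (v a) (v (a \<ominus> e x))" using v_diff[of a "a \<ominus> e x"] xR QR by simp
    ultimately show "v (e x) \<le> v a" using 1 by simp
  qed
  have part2: "v (e x) \<le> \<delta> ^ n * v a" "v (a \<ominus> e x) \<le> v a" if x: "x \<in> S2" for x
  proof -
    have xR: "p x \<in> carrier R" "P x \<in> carrier R" "e x \<in> carrier R"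
      using x S2 SX D_carrier[OF p] D_carrier[OF PD] D_carrier[OF eD] by auto
    have "v (p x) \<le> \<delta> * v q" using d2(2)[OF x] \<delta>(4) by linarith
    then have "v (p x) ^ n \<le> (\<delta> * v q) ^ n" using xR by (intro power_mono v_nonneg)
    then have vP: "v (P x) \<le> \<delta> ^ n * v Q"
      unfolding P_def using xR by (simp add: v_pow vQ(1) power_mult_distrib)
    have "\<delta> ^ n * v Q \<le> 1 * v Q" using \<delta> Q0 by (intro mult_right_mono power_le_one) auto
    then have "v (Q \<ominus> P x) \<le> v Q" using v_diff[OF QR(1) xR(2)] vP by simp
    \<comment> \<open>Thus \<open>e x\<close> is a difference of \<open>n\<close>-th powers of two
      elements whose relative distance is at most \<open>\<delta> ^ n\<close>, and
      \<open>v_pow_diff\<close> preserves that ratio.\<close>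
    moreover have "Q \<ominus> (Q \<ominus> P x) = P x" using xR QR by algebra
    ultimately show "v (e x) \<le> \<delta> ^ n * v a"
      unfolding e_def a_def using v_pow_diff[of Q "Q \<ominus> P x" "\<delta> ^ n" n] xR QR vP \<delta>
      by (simp add: v_pow)
    moreover have "\<delta> ^ n * v a \<le> 1 * v a" using \<delta> Q0 by (intro mult_right_mono power_le_one) auto
    ultimately show "v (a \<ominus> e x) \<le> v a" using v_diff[of a "e x"] xR QR by simp
  qed
  have small: "\<delta> ^ n * v a \<le> \<eta> * v a" using n(1) Q0 by simp
  have dich: "x \<in> S1 \<or> x \<in> S2" if "x \<in> S" for x
    using le[OF that] that by (auto simp: S1 S2)
  have big: "\<delta> ^ n * v a \<le> 1 * v a" using \<delta> Q0 by (intro mult_right_mono power_le_one) auto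
  show thesis
  proof (rule that[OF eD QR(2)])
    show "a \<noteq> \<zero>" using Q0 v_zero by auto
    show "v (e x) \<le> v a" "v (a \<ominus> e x) \<le> v a" if "x \<in> S" for x
      using dich[OF that] part1[of x] part2[of x] big by auto
    show "v (a \<ominus> e x) \<le> \<eta> * v a" if "x \<in> S" "v (h x) < M" for x
      using part1(1)[of x] small that S1 by simp
    show "v (e x) \<le> \<eta> * v a" if "x \<in> S" "v (h x) = M" for x
      using part2(1)[of x] small that S2 by simp
  qed
qed

lemma weak_stone_weierstrass:
  assumes f: "continuous_map X (norm_topology R N) f" and \<epsilon>: "\<epsilon> > 0"
  shows "\<exists>a\<in>carrier R - {\<zero>}. \<exists>g\<in>D. \<forall>x\<in>topspace X. v (a \<otimes> f x \<ominus> g x) < \<epsilon> * v a"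
proof (rule compact_space_induct_local[OF compact, where
      P = "\<lambda>S. \<exists>a\<in>carrier R - {\<zero>}. \<exists>g\<in>D. \<forall>x\<in>S. v (a \<otimes> f x \<ominus> g x) < \<epsilon> * v a"])
  note fR = continuous_map_carrier[OF f]
  have cont_err: "continuous_map X euclideanreal (\<lambda>x. v (a \<otimes> f x \<ominus> g x))"
    if "a \<in> carrier R" "g \<in> D" for a g
    by (intro continuous_map_v continuous_map_diff_norm continuous_map_mult_norm
        continuous_map_const_norm f D_cont that)
  show "\<exists>a\<in>carrier R - {\<zero>}. \<exists>g\<in>D. \<forall>x\<in>{}. v (a \<otimes> f x \<ominus> g x) < \<epsilon> * v a"
    using D_const[of \<one>] by (intro bexI[of _ \<one>]) auto
  show "\<exists>a\<in>carrier R - {\<zero>}. \<exists>g\<in>D. \<forall>x\<in>{z}. v (a \<otimes> f x \<ominus> g x) < \<epsilon> * v a"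
    if z: "z \<in> topspace X" for z
  proof -
    show ?thesis
      using \<epsilon> fR[OF z]
      by (intro bexI[of _ \<one>] bexI[of _ "\<lambda>_. f z"]) (auto simp: D_const v_one v_self_diff)
  qed
  show "\<exists>U. openin X U \<and> S \<subseteq> U \<and> (\<forall>T. closedin X T \<and> T \<subseteq> U \<longrightarrow>
      (\<exists>a\<in>carrier R - {\<zero>}. \<exists>g\<in>D. \<forall>x\<in>T. v (a \<otimes> f x \<ominus> g x) < \<epsilon> * v a))"
    if S: "closedin X S"
      and ex: "\<exists>a\<in>carrier R - {\<zero>}. \<exists>g\<in>D. \<forall>x\<in>S. v (a \<otimes> f x \<ominus> g x) < \<epsilon> * v a" for S
  proof -
    obtain a g where ag: "a \<in> carrier R - {\<zero>}" "g \<in> D" "\<forall>x\<in>S. v (a \<otimes> f x \<ominus> g x) < \<epsilon> * v a"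
      using ex by blast
    let ?U = "{x \<in> topspace X. v (a \<otimes> f x \<ominus> g x) < \<epsilon> * v a}"
    have "openin X ?U" using ag by (intro openin_less_continuous_map cont_err) auto
    moreover have "S \<subseteq> ?U" using ag closedin_subset[OF S] by auto
    ultimately show ?thesis using ag(1,2) by (intro exI[of _ ?U]) blast
  qed
  show "\<exists>a\<in>carrier R - {\<zero>}. \<exists>g\<in>D. \<forall>x\<in>S. v (a \<otimes> f x \<ominus> g x) < \<epsilon> * v a"
    if S: "closedin X S" and xy: "x0 \<in> S" "y0 \<in> S" "x0 \<noteq> y0"
      and IH: "\<And>T. closedin X T \<Longrightarrow> T \<subset> S \<Longrightarrow>
        \<exists>a\<in>carrier R - {\<zero>}. \<exists>g\<in>D. \<forall>x\<in>T. v (a \<otimes> f x \<ominus> g x) < \<epsilon> * v a"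
    for S x0 y0
  proof -
    have SX: "S \<subseteq> topspace X" and Sc: "compactin X S"
      using S compact by (auto simp: closedin_subset closedin_compact_space)
    obtain k where k: "k \<in> D" "k x0 \<noteq> k y0"
      using D_sep xy SX unfolding separates_points_def by blast
    have kR: "k x0 \<in> carrier R" "k y0 \<in> carrier R" using D_carrier[OF k(1)] xy SX by auto
    \<comment> \<open>Subtracting \<open>k x0\<close> makes \<open>h\<close> vanish at
      \<open>x0\<close>, so \<open>S2\<close> misses \<open>x0\<close>; \<open>S1\<close> misses a
      point \<open>z\<close> where the maximum \<open>M\<close> is attained.\<close>
    define h where "h = (\<lambda>x. k x \<ominus> k x0)"
    have h: "h \<in> D" unfolding h_def by (intro D_diff D_const k kR)
    obtain z where z: "z \<in> S" "\<And>x. x \<in> S \<Longrightarrow> v (h x) \<le> v (h z)"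
      using compactin_attains_sup[OF Sc continuous_map_v[OF D_cont[OF h]]] xy(1) by blast
    define M where "M = v (h z)"
    have "h y0 \<noteq> \<zero>" using k(2) kR by (auto simp: h_def r_right_minus_eq)
    then have "v (h y0) > 0" using D_carrier[OF h] xy SX by (intro v_pos) auto
    then have M: "M > 0" using z(2)[OF xy(2)] by (simp add: M_def)
    have x0: "v (h x0) = 0" using kR(1) by (simp add: h_def v_self_diff)
    note le = z(2)[folded M_def]
    define S1 where "S1 = S \<inter> {x \<in> topspace X. v (h x) < M}"
    define S2 where "S2 = S \<inter> {x \<in> topspace X. M \<le> v (h x)}"
    have cl: "closedin X S1" "closedin X S2"
      unfolding S1_def S2_def
      by (intro closedin_Int S closedin_v_less[OF D_cont[OF h] M] closedin_le_continuous_map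
          continuous_map_v D_cont h)+
    have "z \<in> S - S1" "x0 \<in> S - S2" using z(1) xy(1) x0 M by (auto simp: S1_def S2_def M_def)
    then have "S1 \<subset> S" "S2 \<subset> S" by (auto simp: S1_def S2_def)
    then obtain a1 g1 a2 g2 where
      a1: "a1 \<in> carrier R" "a1 \<noteq> \<zero>" and g1: "g1 \<in> D"
      and g1S: "\<And>x. x \<in> S1 \<Longrightarrow> v (a1 \<otimes> f x \<ominus> g1 x) < \<epsilon> * v a1"
      and a2: "a2 \<in> carrier R" "a2 \<noteq> \<zero>" and g2: "g2 \<in> D"
      and g2S: "\<And>x. x \<in> S2 \<Longrightarrow> v (a2 \<otimes> f x \<ominus> g2 x) < \<epsilon> * v a2"
      using IH[OF cl(1)] IH[OF cl(2)] by blast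
    have va: "v a1 > 0" "v a2 > 0" using v_pos a1 a2 by auto
    obtain z1 where z1: "\<And>x. x \<in> S \<Longrightarrow> v (a1 \<otimes> f x \<ominus> g1 x) \<le> v (a1 \<otimes> f z1 \<ominus> g1 z1)"
      using compactin_attains_sup[OF Sc cont_err[OF a1(1) g1]] xy(1) by blast
    obtain z2 where z2: "\<And>x. x \<in> S \<Longrightarrow> v (a2 \<otimes> f x \<ominus> g2 x) \<le> v (a2 \<otimes> f z2 \<ominus> g2 z2)"
      using compactin_attains_sup[OF Sc cont_err[OF a2(1) g2]] xy(1) by blast
    define K where "K = max 1 (max (v (a1 \<otimes> f z1 \<ominus> g1 z1)) (v (a2 \<otimes> f z2 \<ominus> g2 z2)))"
    have K: "K > 0" "\<And>x. x \<in> S \<Longrightarrow> v (a1 \<otimes> f x \<ominus> g1 x) \<le> K"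
      "\<And>x. x \<in> S \<Longrightarrow> v (a2 \<otimes> f x \<ominus> g2 x) \<le> K"
      unfolding K_def using z1 z2 by (simp_all add: le_max_iff_disj)
    \<comment> \<open>The weight of the wrong approximation must offset its error, at most
      \<open>K\<close>, against the smaller of the two tolerances; the 2 makes the estimates strict,
      and the 1 in \<open>K\<close> makes the division legitimate.\<close>
    define \<eta> where "\<eta> = \<epsilon> * min (v a1) (v a2) / (2 * K)"
    have \<eta>: "\<eta> > 0" "\<eta> * K < \<epsilon> * v a1" "\<eta> * K < \<epsilon> * v a2"
    proof -
      have "\<eta> * K = \<epsilon> * min (v a1) (v a2) / 2" using K(1) by (simp add: \<eta>_def)
      moreover have "0 < \<epsilon> * min (v a1) (v a2)" "\<epsilon> * min (v a1) (v a2) \<le> \<epsilon> * v a1"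
        "\<epsilon> * min (v a1) (v a2) \<le> \<epsilon> * v a2" using \<epsilon> va by auto
      ultimately show "\<eta> > 0" "\<eta> * K < \<epsilon> * v a1" "\<eta> * K < \<epsilon> * v a2"
        using K(1) by (auto simp: \<eta>_def)
    qed
    obtain e a where e: "e \<in> D" and a: "a \<in> carrier R" "a \<noteq> \<zero>"
      and e1: "\<And>x. x \<in> S \<Longrightarrow> v (e x) \<le> v a" and e2: "\<And>x. x \<in> S \<Longrightarrow> v (a \<ominus> e x) \<le> v a"
      and e3: "\<And>x. x \<in> S \<Longrightarrow> v (h x) < M \<Longrightarrow> v (a \<ominus> e x) \<le> \<eta> * v a"
      and e4: "\<And>x. x \<in> S \<Longrightarrow> v (h x) = M \<Longrightarrow> v (e x) \<le> \<eta> * v a"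
      using strong_separation[OF S h M le \<eta>(1)] by blast
    have a0: "v a > 0" using v_pos a by blast
    \<comment> \<open>The common denominator: \<open>g1\<close> is multiplied by \<open>a2\<close>
      and \<open>g2\<close> by \<open>a1\<close>, and the two weights \<open>e x\<close> and
      \<open>a \<ominus> e x\<close> add up to \<open>a\<close>.\<close>
    let ?a = "a \<otimes> (a1 \<otimes> a2)"
    let ?g = "\<lambda>x. e x \<otimes> (a2 \<otimes> g1 x) \<oplus> (a \<ominus> e x) \<otimes> (a1 \<otimes> g2 x)"
    have gD: "?g \<in> D" by (intro D_add D_mult D_diff D_const e g1 g2 a a1 a2)
    have aR: "?a \<in> carrier R - {\<zero>}" using a a1 a2 by (simp add: integral_iff)
    have va': "v ?a = v a * v a1 * v a2" using a a1 a2 by (simp add: v_mult)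
    have "v (?a \<otimes> f x \<ominus> ?g x) < \<epsilon> * v ?a" if x: "x \<in> S" for x
    proof -
      have xX: "x \<in> topspace X" using x SX by auto
      note xR = fR[OF xX] D_carrier[OF e xX] D_carrier[OF g1 xX] D_carrier[OF g2 xX]
      define r1 r2 where "r1 = a1 \<otimes> f x \<ominus> g1 x" and "r2 = a2 \<otimes> f x \<ominus> g2 x"
      have r: "r1 \<in> carrier R" "r2 \<in> carrier R" using xR a1 a2 by (auto simp: r1_def r2_def)
      have "?a \<otimes> f x \<ominus> ?g x = e x \<otimes> (a2 \<otimes> r1) \<oplus> (a \<ominus> e x) \<otimes> (a1 \<otimes> r2)"
        unfolding r1_def r2_def using xR a a1 a2 by algebra
      \<comment> \<open>Since the error is bounded by a maximum, each summand only has to stay below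
        the tolerance on its own.\<close>
      then have bound: "v (?a \<otimes> f x \<ominus> ?g x)
          \<le> max (v (e x) * (v a2 * v r1)) (v (a \<ominus> e x) * (v a1 * v r2))"
        using v_add[of "e x \<otimes> (a2 \<otimes> r1)" "(a \<ominus> e x) \<otimes> (a1 \<otimes> r2)"] xR r a a1 a2
        by (simp add: v_mult)
      have nn: "0 \<le> v r1" "0 \<le> v r2" "0 \<le> v (e x)" "0 \<le> v (a \<ominus> e x)"
        using r xR a by (auto intro: v_nonneg)
      have Kr: "v r1 \<le> K" "v r2 \<le> K" using K(2,3)[OF x] by (auto simp: r1_def r2_def)
      consider "x \<in> S1" | "x \<in> S2" using x xX by (force simp: S1_def S2_def)
      then show ?thesis
      proof cases
        case 1
        then have lt: "v r1 < \<epsilon> * v a1" "v (a \<ominus> e x) \<le> \<eta> * v a"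
          using g1S[OF 1] e3[OF x] by (auto simp: r1_def S1_def)
        have "v (e x) * (v a2 * v r1) \<le> v a * (v a2 * v r1)"
          using e1[OF x] nn va by (intro mult_right_mono) auto
        also have "\<dots> < v a * (v a2 * (\<epsilon> * v a1))" using lt a0 va by simp
        finally have A: "v (e x) * (v a2 * v r1) < \<epsilon> * v ?a" by (simp add: va' algebra_simps)
        have "v (a \<ominus> e x) * (v a1 * v r2) \<le> (\<eta> * v a) * (v a1 * K)"
          using lt(2) Kr nn va \<eta> a0 by (intro mult_mono mult_nonneg_nonneg) auto
        also have "\<dots> = (\<eta> * K) * (v a * v a1)" by simp
        also have "\<dots> < (\<epsilon> * v a2) * (v a * v a1)" using \<eta>(3) a0 va by (intro mult_strict_right_mono) auto
        finally have B: "v (a \<ominus> e x) * (v a1 * v r2) < \<epsilon> * v ?a" by (simp add: va' algebra_simps)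
        show ?thesis using bound A B by simp
      next
        case 2
        then have "v (h x) = M" using le[OF x] by (auto simp: S2_def)
        then have lt: "v r2 < \<epsilon> * v a2" "v (e x) \<le> \<eta> * v a"
          using g2S[OF 2] e4[OF x] by (auto simp: r2_def)
        have "v (a \<ominus> e x) * (v a1 * v r2) \<le> v a * (v a1 * v r2)"
          using e2[OF x] nn va by (intro mult_right_mono) auto
        also have "\<dots> < v a * (v a1 * (\<epsilon> * v a2))" using lt a0 va by simp
        finally have A: "v (a \<ominus> e x) * (v a1 * v r2) < \<epsilon> * v ?a" by (simp add: va' algebra_simps)
        have "v (e x) * (v a2 * v r1) \<le> (\<eta> * v a) * (v a2 * K)"
          using lt(2) Kr nn va \<eta> a0 by (intro mult_mono mult_nonneg_nonneg) auto
        also have "\<dots> = (\<eta> * K) * (v a * v a2)" by simp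
        also have "\<dots> < (\<epsilon> * v a1) * (v a * v a2)" using \<eta>(2) a0 va by (intro mult_strict_right_mono) auto
        finally have B: "v (e x) * (v a2 * v r1) < \<epsilon> * v ?a" by (simp add: va' algebra_simps)
        show ?thesis using bound A B by simp
      qed
    qed
    then show ?thesis by (intro bexI[OF _ aR] bexI[OF _ gD] ballI)
  qed
qed

end

section \<open>The algebra of continuous functions\<close>

context normed_cring
begin

interpretation M: Metric_space "carrier R" "norm_dist R N"
  by (rule norm_metric)

lemma C_alg_carrier_iff:
  "f \<in> carrier (C_alg X R N) \<longleftrightarrow>
     f \<in> extensional (topspace X) \<and> continuous_map X (norm_topology R N) f"
  by (simp add: C_alg_def)

lemma C_alg_value: "f \<in> carrier (C_alg X R N) \<Longrightarrow> x \<in> topspace X \<Longrightarrow> f x \<in> carrier R"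
  using continuous_map_carrier[of X f x] by (simp add: C_alg_carrier_iff)

lemma C_alg_restrict:
  "continuous_map X (norm_topology R N) f \<Longrightarrow> restrict f (topspace X) \<in> carrier (C_alg X R N)"
  unfolding C_alg_carrier_iff by (auto intro: continuous_map_eq)

text \<open>Negation in \<open>C_alg\<close> is a definite description, so a pointwise formula
  requires existence and uniqueness of the additive inverse. Uniqueness is pointwise on the space
  and by extensionality elsewhere.\<close>

lemma C_alg_neg:
  assumes f: "f \<in> carrier (C_alg X R N)"
  shows "\<ominus>\<^bsub>C_alg X R N\<^esub> f = (\<lambda>x\<in>topspace X. \<ominus> f x)"
proof -
  let ?A = "C_alg X R N"
  let ?g = "\<lambda>x\<in>topspace X. \<ominus> f x"
  have gA: "?g \<in> carrier ?A"
    using f by (intro C_alg_restrict continuous_map_neg) (simp add: C_alg_carrier_iff)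
  have inv: "f \<oplus>\<^bsub>?A\<^esub> ?g = \<zero>\<^bsub>?A\<^esub>" "?g \<oplus>\<^bsub>?A\<^esub> f = \<zero>\<^bsub>?A\<^esub>"
    using C_alg_value[OF f] by (auto simp: C_alg_def r_neg l_neg intro!: restrict_ext)
  have unique: "y = ?g" if y: "y \<in> carrier ?A" "f \<oplus>\<^bsub>?A\<^esub> y = \<zero>\<^bsub>?A\<^esub>" for y
  proof (rule extensionalityI[of _ "topspace X"])
    show "y \<in> extensional (topspace X)" using y by (simp add: C_alg_carrier_iff)
    fix x assume x: "x \<in> topspace X"
    have "(f \<oplus>\<^bsub>?A\<^esub> y) x = \<zero>\<^bsub>?A\<^esub> x" using y(2) by simp
    then have "f x \<oplus> y x = \<zero>" using x by (simp add: C_alg_def)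
    then show "y x = ?g x"
      using x C_alg_value[OF f x] C_alg_value[OF y(1) x] minus_equality[of "y x" "f x"]
      by (simp add: a_comm)
  qed simp
  have "(THE y. y \<in> carrier ?A \<and> f \<oplus>\<^bsub>?A\<^esub> y = \<zero>\<^bsub>?A\<^esub> \<and> y \<oplus>\<^bsub>?A\<^esub> f = \<zero>\<^bsub>?A\<^esub>) = ?g"
  proof (rule the_equality)
    show "?g \<in> carrier ?A \<and> f \<oplus>\<^bsub>?A\<^esub> ?g = \<zero>\<^bsub>?A\<^esub> \<and> ?g \<oplus>\<^bsub>?A\<^esub> f = \<zero>\<^bsub>?A\<^esub>"
      using gA inv by (intro conjI)
  qed (elim conjE, rule unique)
  then show ?thesis unfolding a_inv_def[of ?A] m_inv_def[of "add_monoid ?A"] by simp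
qed

lemma C_alg_minus:
  assumes "f \<in> carrier (C_alg X R N)" "g \<in> carrier (C_alg X R N)"
  shows "f \<ominus>\<^bsub>C_alg X R N\<^esub> g = (\<lambda>x\<in>topspace X. f x \<ominus> g x)"
  unfolding a_minus_def C_alg_neg[OF assms(2)]
  by (auto simp: C_alg_def intro!: restrict_ext)

lemma norm_dist_C_alg:
  assumes "f \<in> carrier (C_alg X R N)" "g \<in> carrier (C_alg X R N)"
  shows "norm_dist (C_alg X R N) (sup_norm X N) f g
    = Sup (insert 0 ((\<lambda>x. N (f x \<ominus> g x)) ` topspace X))"
proof -
  have "(\<lambda>x. N ((\<lambda>x\<in>topspace X. f x \<ominus> g x) x)) ` topspace X = (\<lambda>x. N (f x \<ominus> g x)) ` topspace X"
    by (intro image_cong) auto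
  then show ?thesis using assms by (simp add: norm_dist_def C_alg_minus sup_norm_def)
qed

lemma norm_dist_C_alg_le:
  assumes "f \<in> carrier (C_alg X R N)" "g \<in> carrier (C_alg X R N)"
    and "0 \<le> c" "\<And>x. x \<in> topspace X \<Longrightarrow> N (f x \<ominus> g x) \<le> c"
  shows "norm_dist (C_alg X R N) (sup_norm X N) f g \<le> c"
  unfolding norm_dist_C_alg[OF assms(1,2)] using assms(3,4) by (intro cSup_least) auto

context
  fixes X :: "'x topology"
  assumes compact: "compact_space X"
begin

lemma bdd_above_norm_diff:
  assumes f: "f \<in> carrier (C_alg X R N)" and g: "g \<in> carrier (C_alg X R N)"
  shows "bdd_above (insert 0 ((\<lambda>x. N (f x \<ominus> g x)) ` topspace X))"
proof -
  have "continuous_map X (norm_topology R N) (\<lambda>x. f x \<ominus> g x)"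
    using f g by (intro continuous_map_diff_norm) (auto simp: C_alg_carrier_iff)
  then have "continuous_map X euclideanreal (\<lambda>x. N (f x \<ominus> g x))"
    using continuous_map_compose[OF _ continuous_map_norm] by (force simp: o_def)
  moreover have "compactin X (topspace X)" using compact by (simp add: compact_space_def)
  ultimately have "compactin euclideanreal ((\<lambda>x. N (f x \<ominus> g x)) ` topspace X)"
    using image_compactin by blast
  then show ?thesis by (simp add: compact_imp_bounded bounded_imp_bdd_above)
qed

lemma norm_dist_C_alg_ge:
  assumes f: "f \<in> carrier (C_alg X R N)" and g: "g \<in> carrier (C_alg X R N)"
  shows "0 \<le> norm_dist (C_alg X R N) (sup_norm X N) f g"
    and "x \<in> topspace X \<Longrightarrow> N (f x \<ominus> g x) \<le> norm_dist (C_alg X R N) (sup_norm X N) f g"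
  unfolding norm_dist_C_alg[OF f g] by (auto intro!: cSup_upper bdd_above_norm_diff f g)

text \<open>This gives access to the ball description of closures in \<open>norm_topology\<close>.
  Compactness enters through the finiteness of the suprema.\<close>

lemma Metric_space_C_alg:
  "Metric_space (carrier (C_alg X R N)) (norm_dist (C_alg X R N) (sup_norm X N))"
proof
  let ?A = "C_alg X R N" and ?d = "norm_dist (C_alg X R N) (sup_norm X N)"
  show "0 \<le> ?d f g" for f g
    using norm_dist_C_alg_ge(1)[of f g]
    by (cases "f \<in> carrier ?A \<and> g \<in> carrier ?A") (auto simp: norm_dist_def)
  show "?d f g = ?d g f" for f g
  proof (cases "f \<in> carrier ?A \<and> g \<in> carrier ?A")
    case True
    then have "(\<lambda>x. N (f x \<ominus> g x)) ` topspace X = (\<lambda>x. N (g x \<ominus> f x)) ` topspace X"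
      by (intro image_cong refl norm_minus_swap) (auto intro: C_alg_value)
    then show ?thesis using True by (simp add: norm_dist_C_alg)
  qed (auto simp: norm_dist_def)
  show "?d f g = 0 \<longleftrightarrow> f = g" if fg: "f \<in> carrier ?A" "g \<in> carrier ?A" for f g
  proof
    assume 0: "?d f g = 0"
    show "f = g"
    proof (rule extensionalityI[of _ "topspace X"])
      fix x assume x: "x \<in> topspace X"
      have c: "f x \<in> carrier R" "g x \<in> carrier R" using fg x by (auto intro: C_alg_value)
      then have "N (f x \<ominus> g x) = 0"
        using norm_dist_C_alg_ge(2)[OF fg x] 0 norm_nonneg[of "f x \<ominus> g x"] by auto
      then show "f x = g x" using c norm_zero_iff[of "f x \<ominus> g x"] by simp
    qed (use fg in \<open>auto simp: C_alg_carrier_iff\<close>)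
  next
    assume eq: "f = g"
    have "N (f x \<ominus> f x) \<le> 0" if "x \<in> topspace X" for x
      using C_alg_value[OF fg(1) that] norm_zero_iff[of "f x \<ominus> f x"] by simp
    then have "?d f f \<le> 0" using fg by (intro norm_dist_C_alg_le) auto
    then show "?d f g = 0" using norm_dist_C_alg_ge(1)[OF fg] eq by simp
  qed
  show "?d f h \<le> ?d f g + ?d g h"
    if fgh: "f \<in> carrier ?A" "g \<in> carrier ?A" "h \<in> carrier ?A" for f g h
  proof (rule norm_dist_C_alg_le[OF fgh(1,3)])
    show "0 \<le> ?d f g + ?d g h" using fgh norm_dist_C_alg_ge(1) by (intro add_nonneg_nonneg) auto
    fix x assume x: "x \<in> topspace X"
    have c: "f x \<in> carrier R" "g x \<in> carrier R" "h x \<in> carrier R"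
      using fgh x by (auto intro: C_alg_value)
    have "f x \<ominus> h x = (f x \<ominus> g x) \<oplus> (g x \<ominus> h x)" using c by algebra
    then have "N (f x \<ominus> h x) \<le> N (f x \<ominus> g x) + N (g x \<ominus> h x)" using c norm_add by simp
    also have "\<dots> \<le> ?d f g + ?d g h" using fgh x by (intro add_mono norm_dist_C_alg_ge(2))
    finally show "N (f x \<ominus> h x) \<le> ?d f g + ?d g h" .
  qed
qed

text \<open>Density for the supremum norm becomes a pointwise estimate. A supremum may equal its
  bound, so a ball of radius \<open>r\<close> is entered with error \<open>r / 2\<close>.\<close>

lemma satisfies_stone_weierstrassI:
  assumes approx: "\<And>B f \<epsilon>. subalgebra_of B R (C_alg X R N) \<Longrightarrow> separates_points X B \<Longrightarrow>
      f \<in> carrier (C_alg X R N) \<Longrightarrow> \<epsilon> > 0 \<Longrightarrow>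
      \<exists>u\<in>carrier (C_alg X R N). \<exists>a\<in>carrier R - {\<zero>}. a \<odot>\<^bsub>C_alg X R N\<^esub> u \<in> B \<and>
        (\<forall>x\<in>topspace X. N (f x \<ominus> u x) \<le> \<epsilon>)"
  shows "satisfies_stone_weierstrass X R N"
  unfolding satisfies_stone_weierstrass_def
proof (intro allI impI)
  let ?A = "C_alg X R N"
  interpret C: Metric_space "carrier ?A" "norm_dist ?A (sup_norm X N)" by (rule Metric_space_C_alg)
  fix B assume B: "subalgebra_of B R ?A \<and> separates_points X B"
  let ?S = "{f \<in> carrier ?A. \<exists>a\<in>carrier R - {\<zero>}. a \<odot>\<^bsub>?A\<^esub> f \<in> B}"
  have "\<exists>u\<in>?S. u \<in> C.mball f r" if f: "f \<in> carrier ?A" and r: "r > 0" for f r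
  proof -
    obtain u where u: "u \<in> ?S" "\<And>x. x \<in> topspace X \<Longrightarrow> N (f x \<ominus> u x) \<le> r / 2"
      using approx[of B f "r / 2"] B f r by auto
    have "norm_dist ?A (sup_norm X N) f u \<le> r / 2"
      using u f r by (intro norm_dist_C_alg_le) auto
    then show ?thesis using u(1) f r by (intro bexI[of _ u]) auto
  qed
  then show "norm_topology ?A (sup_norm X N) closure_of ?S = carrier ?A"
    unfolding norm_topology_def C.metric_closure_of by auto
qed

end

text \<open>Closure is phrased for functions whose restriction lies in \<open>B\<close>; this is the
  form in which total functions model the subalgebra. Constants are scalar multiples of the
  unit.\<close>

lemma restrict_subalgebra_closed:
  assumes B: "subalgebra_of B R (C_alg X R N)"
  shows "B \<subseteq> carrier (C_alg X R N)"
    and "restrict g (topspace X) \<in> B \<Longrightarrow> continuous_map X (norm_topology R N) g"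
    and "c \<in> carrier R \<Longrightarrow> restrict (\<lambda>_. c) (topspace X) \<in> B"
    and "restrict g (topspace X) \<in> B \<Longrightarrow> restrict h (topspace X) \<in> B \<Longrightarrow>
      (\<lambda>x\<in>topspace X. g x \<oplus> h x) \<in> B"
    and "restrict g (topspace X) \<in> B \<Longrightarrow> restrict h (topspace X) \<in> B \<Longrightarrow>
      (\<lambda>x\<in>topspace X. g x \<otimes> h x) \<in> B"
    and "c \<in> carrier R \<Longrightarrow> restrict g (topspace X) \<in> B \<Longrightarrow> (\<lambda>x\<in>topspace X. c \<otimes> g x) \<in> B"
proof -
  let ?A = "C_alg X R N"
  have sr: "subring B ?A" and sm: "submodule B R ?A" using B by (auto simp: subalgebra_of_def)
  show sub: "B \<subseteq> carrier ?A" using subringE(1)[OF sr] .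
  show "continuous_map X (norm_topology R N) g" if "restrict g (topspace X) \<in> B"
  proof (rule continuous_map_eq)
    show "continuous_map X (norm_topology R N) (restrict g (topspace X))"
      using sub that by (auto simp: C_alg_carrier_iff)
  qed simp
  show smult: "(\<lambda>x\<in>topspace X. c \<otimes> g x) \<in> B" if "c \<in> carrier R" "restrict g (topspace X) \<in> B" for c g
  proof -
    have "c \<odot>\<^bsub>?A\<^esub> restrict g (topspace X) = (\<lambda>x\<in>topspace X. c \<otimes> g x)"
      by (auto simp: C_alg_def intro!: restrict_ext)
    then show ?thesis using submodule.smult_closed[OF sm that] by simp
  qed
  show "restrict (\<lambda>_. c) (topspace X) \<in> B" if "c \<in> carrier R"
  proof -
    have "(\<lambda>x\<in>topspace X. \<one>) \<in> B" using subringE(3)[OF sr] by (simp add: C_alg_def)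
    then show ?thesis using smult[OF that, of "\<lambda>_. \<one>"] that by simp
  qed
  show "(\<lambda>x\<in>topspace X. g x \<oplus> h x) \<in> B"
    if "restrict g (topspace X) \<in> B" "restrict h (topspace X) \<in> B"
  proof -
    have "restrict g (topspace X) \<oplus>\<^bsub>?A\<^esub> restrict h (topspace X) = (\<lambda>x\<in>topspace X. g x \<oplus> h x)"
      by (auto simp: C_alg_def intro!: restrict_ext)
    then show ?thesis using subringE(7)[OF sr that] by simp
  qed
  show "(\<lambda>x\<in>topspace X. g x \<otimes> h x) \<in> B"
    if "restrict g (topspace X) \<in> B" "restrict h (topspace X) \<in> B"
  proof -
    have "restrict g (topspace X) \<otimes>\<^bsub>?A\<^esub> restrict h (topspace X) = (\<lambda>x\<in>topspace X. g x \<otimes> h x)"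
      by (auto simp: C_alg_def intro!: restrict_ext)
    then show ?thesis using subringE(6)[OF sr that] by simp
  qed
qed

end

text \<open>The function algebra is the preimage of \<open>B\<close> under restriction. It contains
  \<open>B\<close>, whose members are extensional, and so it inherits the separation of
  points.\<close>

lemma (in ultrametric_domain) subalgebra_approximation:
  fixes X :: "'x topology"
  assumes X: "compact_space X" and B: "subalgebra_of B R (C_alg X R N)" and sep: "separates_points X B"
    and f: "f \<in> carrier (C_alg X R N)" and \<epsilon>: "\<epsilon> > 0"
  obtains a g where "a \<in> carrier R" "a \<noteq> \<zero>" "restrict g (topspace X) \<in> B"
    "\<And>x. x \<in> topspace X \<Longrightarrow> g x \<in> carrier R"
    "\<And>x. x \<in> topspace X \<Longrightarrow> v (a \<otimes> f x \<ominus> g x) < \<epsilon> * v a"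
proof -
  note cl = restrict_subalgebra_closed[OF B]
  interpret ultrametric_function_algebra R N v X "{g. restrict g (topspace X) \<in> B}"
  proof
    show "separates_points X {g. restrict g (topspace X) \<in> B}"
    proof -
      have "restrict b (topspace X) = b" if "b \<in> B" for b
        using cl(1) that by (auto simp: C_alg_carrier_iff extensional_restrict)
      then have "B \<subseteq> {g. restrict g (topspace X) \<in> B}" by auto
      then show ?thesis using sep unfolding separates_points_def by blast
    qed
    fix g h :: "'x \<Rightarrow> 'a"
    assume g: "g \<in> {g. restrict g (topspace X) \<in> B}" and "\<And>x. x \<in> topspace X \<Longrightarrow> g x = h x"
    then have "restrict g (topspace X) = restrict h (topspace X)" by (intro restrict_ext)
    then show "h \<in> {g. restrict g (topspace X) \<in> B}" using g by simp
  qed (use X cl in auto)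
  have "continuous_map X (norm_topology R N) f" using f by (simp add: C_alg_carrier_iff)
  from weak_stone_weierstrass[OF this \<epsilon>] obtain a g where "a \<in> carrier R - {\<zero>}"
    "restrict g (topspace X) \<in> B" "\<forall>x\<in>topspace X. v (a \<otimes> f x \<ominus> g x) < \<epsilon> * v a" by auto
  then show thesis using continuous_map_carrier[OF cl(2)] by (intro that[of a g]) auto
qed

lemma stone_weierstrass_discrete_domain:
  assumes "normed_cring R N" and "domain R" and X: "compact_space X"
    and \<delta>: "\<delta> > 0" "\<And>x. x \<in> carrier R \<Longrightarrow> x \<noteq> \<zero>\<^bsub>R\<^esub> \<Longrightarrow> \<delta> \<le> N x"
  shows "satisfies_stone_weierstrass X R N"
proof -
  interpret normed_cring R N by fact
  interpret domain R by fact
  define v :: "'a \<Rightarrow> real" where "v x = (if x = \<zero>\<^bsub>R\<^esub> then 0 else 1)" for x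
  interpret ultrametric_domain R N v
  proof
    \<comment> \<open>Distinct elements are at least \<open>\<delta>\<close> apart, so the modulus
      \<open>t / \<delta>\<close> is at least 1 there and dominates every jump of
      \<open>v\<close>.\<close>
    show "continuous_map (norm_topology R N) euclideanreal v"
    proof (rule continuous_map_real_if_norm_bound[where \<phi> = "\<lambda>t. t / \<delta>"])
      show "((\<lambda>t. t / \<delta>) \<longlongrightarrow> 0) (at_right 0)"
        using \<delta>(1) by (auto intro!: tendsto_eq_intros)
      show "\<bar>v y - v x\<bar> \<le> N (y \<ominus>\<^bsub>R\<^esub> x) / \<delta>"
        if "x \<in> carrier R" "y \<in> carrier R" "x \<noteq> y" for x y
      proof -
        have "\<delta> \<le> N (y \<ominus>\<^bsub>R\<^esub> x)" using that by (intro \<delta>(2)) auto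
        then have "1 \<le> N (y \<ominus>\<^bsub>R\<^esub> x) / \<delta>" using \<delta>(1) by simp
        moreover have "\<bar>v y - v x\<bar> \<le> 1" by (simp add: v_def)
        ultimately show ?thesis by linarith
      qed
    qed
  qed (auto simp: v_def integral_iff)
  show ?thesis
  proof (rule satisfies_stone_weierstrassI[OF X])
    fix B f and \<epsilon> :: real
    assume B: "subalgebra_of B R (C_alg X R N)" and sep: "separates_points X B"
      and f: "f \<in> carrier (C_alg X R N)" and \<epsilon>: "\<epsilon> > 0"
    \<comment> \<open>With tolerance 1 the error has trivial norm below 1, hence is zero. So
      \<open>f\<close> itself has a multiple in \<open>B\<close> and is its own approximant.\<close>
    obtain a g where a: "a \<in> carrier R" "a \<noteq> \<zero>\<^bsub>R\<^esub>" and g: "restrict g (topspace X) \<in> B"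
      and gR: "\<And>x. x \<in> topspace X \<Longrightarrow> g x \<in> carrier R"
      and lt: "\<And>x. x \<in> topspace X \<Longrightarrow> v (a \<otimes>\<^bsub>R\<^esub> f x \<ominus>\<^bsub>R\<^esub> g x) < 1 * v a"
      using subalgebra_approximation[OF X B sep f zero_less_one] by metis
    have "a \<otimes>\<^bsub>R\<^esub> f x = g x" if "x \<in> topspace X" for x
      using lt[OF that] a gR[OF that] C_alg_value[OF f that] by (simp add: v_def split: if_splits)
    then have "a \<odot>\<^bsub>C_alg X R N\<^esub> f = restrict g (topspace X)"
      by (auto simp: C_alg_def intro!: restrict_ext)
    moreover have "N (f x \<ominus>\<^bsub>R\<^esub> f x) \<le> \<epsilon>" if "x \<in> topspace X" for x
      using C_alg_value[OF f that] norm_zero_iff[of "f x \<ominus>\<^bsub>R\<^esub> f x"] \<epsilon> by simp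
    ultimately show "\<exists>u\<in>carrier (C_alg X R N). \<exists>a\<in>carrier R - {\<zero>\<^bsub>R\<^esub>}.
        a \<odot>\<^bsub>C_alg X R N\<^esub> u \<in> B \<and> (\<forall>x\<in>topspace X. N (f x \<ominus>\<^bsub>R\<^esub> u x) \<le> \<epsilon>)"
      using f a g by (intro bexI[of _ f] bexI[of _ a]) auto
  qed
qed

section \<open>Transport along isomorphisms and the individual cases\<close>

lemma comm_monoid_AbA_imp_normed_cring: "comm_monoid_AbA R N \<Longrightarrow> normed_cring R N"
  by (simp add: comm_monoid_AbA_def banach_ab_group_def normed_cring_def normed_cring_axioms_def)

text \<open>The constant in \<open>bounded_map\<close> carries no sign; passing to
  \<open>max 1 C\<close> allows division by it.\<close>

lemma bounded_mapE:
  assumes "bounded_map R N N' h" and "\<And>x. x \<in> carrier R \<Longrightarrow> 0 \<le> N x"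
  obtains C where "C > 0" "\<And>x. x \<in> carrier R \<Longrightarrow> N' (h x) \<le> C * N x"
proof -
  obtain C where C: "\<And>x. x \<in> carrier R \<Longrightarrow> N' (h x) \<le> C * N x"
    using assms(1) by (auto simp: bounded_map_def)
  have "N' (h x) \<le> max 1 C * N x" if "x \<in> carrier R" for x
    using C[OF that] mult_right_mono[of C "max 1 C" "N x"] assms(2)[OF that] by simp
  then show thesis using that[of "max 1 C"] by simp
qed

lemma domain_ring_iso:
  assumes h: "h \<in> ring_iso R S" and "cring R" and "domain S"
  shows "domain R"
proof -
  interpret R: cring R by fact
  interpret S: domain S by fact
  have hom: "h \<in> ring_hom R S" and bij: "bij_betw h (carrier R) (carrier S)"
    using h by (auto simp: ring_iso_def)
  have h0: "h \<zero>\<^bsub>R\<^esub> = \<zero>\<^bsub>S\<^esub>" using ring_hom_zero[OF hom R.ring_axioms S.ring_axioms] .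
  have inj: "x = \<zero>\<^bsub>R\<^esub>" if "x \<in> carrier R" "h x = \<zero>\<^bsub>S\<^esub>" for x
    using inj_onD[OF bij_betw_imp_inj_on[OF bij], of x "\<zero>\<^bsub>R\<^esub>"] that h0 by simp
  show ?thesis
  proof
    show "\<one>\<^bsub>R\<^esub> \<noteq> \<zero>\<^bsub>R\<^esub>" using ring_hom_one[OF hom] h0 S.one_not_zero by auto
    fix x y assume xy: "x \<otimes>\<^bsub>R\<^esub> y = \<zero>\<^bsub>R\<^esub>" "x \<in> carrier R" "y \<in> carrier R"
    then have "h x \<otimes>\<^bsub>S\<^esub> h y = \<zero>\<^bsub>S\<^esub>" using ring_hom_mult[OF hom] h0 by metis
    then show "x = \<zero>\<^bsub>R\<^esub> \<or> y = \<zero>\<^bsub>R\<^esub>"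
      using S.integral ring_hom_closed[OF hom] inj xy by meson
  qed
qed

text \<open>From \<open>1 \<le> N' (h x) \<le> C * N x\<close> nonzero elements of \<open>R\<close>
  have norm at least \<open>1 / C\<close>. This covers both norms on the integers and the trivial
  norm on the reals.\<close>

lemma stone_weierstrass_iso_discrete_domain:
  assumes iso: "monoid_iso_AbA R N S N' h" and S: "domain S"
    and N': "\<And>y. y \<in> carrier S \<Longrightarrow> y \<noteq> \<zero>\<^bsub>S\<^esub> \<Longrightarrow> 1 \<le> N' y" and X: "compact_space X"
  shows "satisfies_stone_weierstrass X R N"
proof -
  have R: "comm_monoid_AbA R N" and h: "h \<in> ring_iso R S" and b: "bounded_map R N N' h"
    using iso by (auto simp: monoid_iso_AbA_def)
  interpret normed_cring R N using R by (rule comm_monoid_AbA_imp_normed_cring)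
  interpret S: domain S by fact
  obtain C where C: "C > 0" "\<And>x. x \<in> carrier R \<Longrightarrow> N' (h x) \<le> C * N x"
    using bounded_mapE[OF b norm_nonneg] by blast
  have hom: "h \<in> ring_hom R S" and inj: "inj_on h (carrier R)"
    using h by (auto simp: ring_iso_def bij_betw_def)
  have h0: "h \<zero>\<^bsub>R\<^esub> = \<zero>\<^bsub>S\<^esub>" using ring_hom_zero[OF hom ring_axioms S.ring_axioms] .
  have "1 / C \<le> N x" if x: "x \<in> carrier R" "x \<noteq> \<zero>\<^bsub>R\<^esub>" for x
  proof -
    have "h x \<noteq> \<zero>\<^bsub>S\<^esub>" using inj_onD[OF inj, of x "\<zero>\<^bsub>R\<^esub>"] x h0 by auto
    then have "1 \<le> C * N x" using N'[of "h x"] C(2)[OF x(1)] ring_hom_closed[OF hom x(1)] by linarith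
    then show ?thesis using C(1) by (simp add: field_simps)
  qed
  then show ?thesis
    using C(1) domain_ring_iso[OF h is_cring S] X
    by (intro stone_weierstrass_discrete_domain[of R N X "1 / C"] normed_cring_axioms) auto
qed

lemma domain_real_ring: "domain real_ring"
proof -
  have "cring real_ring"
  proof (rule cringI)
    show "abelian_group real_ring"
    proof (rule abelian_groupI)
      fix x :: real
      show "\<exists>y\<in>carrier real_ring. y \<oplus>\<^bsub>real_ring\<^esub> x = \<zero>\<^bsub>real_ring\<^esub>"
        by (intro bexI[of _ "- x"]) (auto simp: real_ring_def)
    qed (auto simp: real_ring_def)
    show "comm_monoid real_ring" by (rule comm_monoidI) (auto simp: real_ring_def)
  qed (auto simp: real_ring_def algebra_simps)
  then show ?thesis
    by (intro domain.intro) (auto simp: domain_axioms_def real_ring_def)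
qed

lemma stone_weierstrass_iso_real:
  assumes iso: "monoid_iso_AbA R N real_ring (real_pow_norm e) h" and e: "e > 0"
    and X: "compact_space X"
  shows "satisfies_stone_weierstrass X R N"
proof -
  have R: "comm_monoid_AbA R N" and h: "h \<in> ring_iso R real_ring"
    and b: "bounded_map R N (real_pow_norm e) h"
    and b': "bounded_map real_ring (real_pow_norm e) N (inv_into (carrier R) h)"
    using iso by (auto simp: monoid_iso_AbA_def)
  interpret normed_cring R N using R by (rule comm_monoid_AbA_imp_normed_cring)
  interpret dR: domain R using domain_ring_iso[OF h is_cring domain_real_ring] .
  have hom: "h \<in> ring_hom R real_ring" and bij: "bij_betw h (carrier R) UNIV"
    using h by (auto simp: ring_iso_def real_ring_def)
  define k where "k = inv_into (carrier R) h"
  have kR: "k t \<in> carrier R" and hk: "h (k t) = t" for t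
    using bij by (auto simp: k_def bij_betw_def f_inv_into_f intro!: inv_into_into)
  have kh: "k (h x) = x" if "x \<in> carrier R" for x
    using bij that by (simp add: k_def bij_betw_def)
  have h_add: "h (x \<oplus>\<^bsub>R\<^esub> y) = h x + h y" and h_mult: "h (x \<otimes>\<^bsub>R\<^esub> y) = h x * h y"
    if "x \<in> carrier R" "y \<in> carrier R" for x y
    using ring_hom_add[OF hom that] ring_hom_mult[OF hom that] by (auto simp: real_ring_def)
  have k_add: "k (s + t) = k s \<oplus>\<^bsub>R\<^esub> k t" and k_mult: "k (s * t) = k s \<otimes>\<^bsub>R\<^esub> k t" for s t
    using kh[of "k s \<oplus>\<^bsub>R\<^esub> k t"] kh[of "k s \<otimes>\<^bsub>R\<^esub> k t"] by (simp_all add: h_add h_mult hk kR)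
  have h_diff: "h (x \<ominus>\<^bsub>R\<^esub> y) = h x - h y" if "x \<in> carrier R" "y \<in> carrier R" for x y
  proof -
    have "x \<ominus>\<^bsub>R\<^esub> y \<oplus>\<^bsub>R\<^esub> y = x" using that by algebra
    then show ?thesis using h_add[of "x \<ominus>\<^bsub>R\<^esub> y" y] that by simp
  qed
  obtain C where C: "C > 0" "\<And>x. x \<in> carrier R \<Longrightarrow> \<bar>h x\<bar> powr e \<le> C * N x"
    using bounded_mapE[OF b norm_nonneg] unfolding real_pow_norm_def by blast
  obtain C' where C': "C' > 0" "\<And>t. N (k t) \<le> C' * \<bar>t\<bar> powr e"
    using bounded_mapE[OF b'] unfolding real_pow_norm_def k_def by (auto simp: real_ring_def)
  \<comment> \<open>Boundedness controls the power \<open>\<bar>h x\<bar> powr e\<close>, so the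
    modulus of continuity of \<open>h\<close> is a power with exponent \<open>1 / e\<close>.\<close>
  have h_cont: "continuous_map (norm_topology R N) euclideanreal h"
  proof (rule continuous_map_real_if_norm_bound[where \<phi> = "\<lambda>t. (C * t) powr (1 / e)"])
    have "((\<lambda>t. (C * t) powr (1 / e)) \<longlongrightarrow> (C * 0) powr (1 / e)) (at_right 0)"
      using e C(1) by (intro tendsto_powr2 tendsto_intros)
        (auto simp: eventually_at_right_field intro!: exI[of _ 1])
    then show "((\<lambda>t. (C * t) powr (1 / e)) \<longlongrightarrow> 0) (at_right 0)" by simp
    fix x y assume xy: "x \<in> carrier R" "y \<in> carrier R"
    have "(\<bar>h y - h x\<bar> powr e) powr (1 / e) \<le> (C * N (y \<ominus>\<^bsub>R\<^esub> x)) powr (1 / e)"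
      using C(2)[of "y \<ominus>\<^bsub>R\<^esub> x"] xy e by (intro powr_mono2) (auto simp: h_diff)
    then show "\<bar>h y - h x\<bar> \<le> (C * N (y \<ominus>\<^bsub>R\<^esub> x)) powr (1 / e)" using e by (simp add: powr_powr)
  qed
  have comp: "continuous_map X euclideanreal (\<lambda>x. h (u x))"
    if "continuous_map X (norm_topology R N) u" for u
    using continuous_map_compose[OF that h_cont] by (simp add: o_def)
  show ?thesis
  proof (rule satisfies_stone_weierstrassI[OF X])
    fix B f and \<epsilon> :: real
    assume B: "subalgebra_of B R (C_alg X R N)" and sep: "separates_points X B"
      and f: "f \<in> carrier (C_alg X R N)" and \<epsilon>: "\<epsilon> > 0"
    note cl = restrict_subalgebra_closed[OF B]
    \<comment> \<open>The subalgebra is carried over to real-valued functions. The tolerance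
      \<open>d\<close> below solves \<open>C' * d powr e = \<epsilon>\<close>, which converts a
      Euclidean error back into one for \<open>N\<close>.\<close>
    define D where "D = {\<phi>. (\<lambda>x\<in>topspace X. k (\<phi> x)) \<in> B}"
    define d where "d = (\<epsilon> / C') powr (1 / e)"
    have d: "d > 0" "C' * d powr e = \<epsilon>" using \<epsilon> C'(1) e by (auto simp: d_def powr_powr)
    have "\<exists>\<phi>\<in>D. \<forall>x\<in>topspace X. \<bar>h (f x) - \<phi> x\<bar> < d"
    proof (rule stone_weierstrass_real[OF X])
      show "continuous_map X euclideanreal \<phi>" if "\<phi> \<in> D" for \<phi>
        using comp[OF cl(2)[of "\<lambda>x. k (\<phi> x)"]] that by (simp add: D_def hk)
      show "(\<lambda>_. c) \<in> D" for c using cl(3)[OF kR] by (simp add: D_def)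
      show "(\<lambda>x. \<phi> x + \<psi> x) \<in> D" "(\<lambda>x. \<phi> x * \<psi> x) \<in> D" if "\<phi> \<in> D" "\<psi> \<in> D" for \<phi> \<psi>
        using that cl(4,5)[of "\<lambda>x. k (\<phi> x)" "\<lambda>x. k (\<psi> x)"] by (auto simp: D_def k_add k_mult)
      show "separates_points X D"
        unfolding separates_points_def
      proof (intro ballI impI)
        fix x y assume xy: "x \<in> topspace X" "y \<in> topspace X" "x \<noteq> y"
        then obtain b where b: "b \<in> B" "b x \<noteq> b y" using sep unfolding separates_points_def by blast
        then have bA: "b \<in> carrier (C_alg X R N)" using cl(1) by blast
        then have "(\<lambda>x\<in>topspace X. k (h (b x))) = b"
          by (intro extensionalityI[of _ "topspace X"])
            (auto simp: C_alg_carrier_iff kh C_alg_value[OF bA])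
        then have "(\<lambda>x. h (b x)) \<in> D" using b by (simp add: D_def)
        moreover have "h (b x) \<noteq> h (b y)"
          using b(2) kh C_alg_value[OF bA] xy by metis
        ultimately show "\<exists>\<phi>\<in>D. \<phi> x \<noteq> \<phi> y" by (intro bexI[of _ "\<lambda>x. h (b x)"])
      qed
      show "continuous_map X euclideanreal (\<lambda>x. h (f x))"
        using comp f by (simp add: C_alg_carrier_iff)
    qed (rule d)
    then obtain \<phi> where \<phi>: "\<phi> \<in> D" "\<And>x. x \<in> topspace X \<Longrightarrow> \<bar>h (f x) - \<phi> x\<bar> < d" by blast
    define u where "u = (\<lambda>x\<in>topspace X. k (\<phi> x))"
    have u: "u \<in> B" using \<phi>(1) by (simp add: u_def D_def)
    then have uA: "u \<in> carrier (C_alg X R N)" using cl(1) by blast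
    have "\<one>\<^bsub>R\<^esub> \<odot>\<^bsub>C_alg X R N\<^esub> u = u"
      by (auto simp: C_alg_def u_def kR intro!: restrict_ext)
    moreover have "N (f x \<ominus>\<^bsub>R\<^esub> u x) \<le> \<epsilon>" if x: "x \<in> topspace X" for x
    proof -
      have c: "f x \<in> carrier R" "u x \<in> carrier R" using C_alg_value[OF f x] C_alg_value[OF uA x] by auto
      have "h (f x \<ominus>\<^bsub>R\<^esub> u x) = h (f x) - \<phi> x" using c x by (simp add: h_diff u_def hk)
      then have "k (h (f x) - \<phi> x) = f x \<ominus>\<^bsub>R\<^esub> u x" using kh[of "f x \<ominus>\<^bsub>R\<^esub> u x"] c by simp
      then have "N (f x \<ominus>\<^bsub>R\<^esub> u x) \<le> C' * \<bar>h (f x) - \<phi> x\<bar> powr e" using C'(2) by metis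
      also have "\<dots> \<le> C' * d powr e"
        using C'(1) \<phi>(2)[OF x] e by (intro mult_left_mono powr_mono2) auto
      finally show ?thesis using d(2) by simp
    qed
    ultimately show "\<exists>u\<in>carrier (C_alg X R N). \<exists>a\<in>carrier R - {\<zero>\<^bsub>R\<^esub>}.
        a \<odot>\<^bsub>C_alg X R N\<^esub> u \<in> B \<and> (\<forall>x\<in>topspace X. N (f x \<ominus>\<^bsub>R\<^esub> u x) \<le> \<epsilon>)"
      using uA u by (intro bexI[of _ u] bexI[of _ "\<one>\<^bsub>R\<^esub>"]) auto
  qed
qed

text \<open>The denominator is invertible, so dividing by it gives an approximant in
  \<open>B\<close> itself with error below \<open>\<epsilon> / C'\<close> for \<open>v\<close>. The
  bound \<open>N x \<le> C' * v x\<close> then returns to the given norm.\<close>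

lemma stone_weierstrass_iso_na_field:
  assumes iso: "monoid_iso_AbA R N K w h" and K: "complete_na_valued_field K w"
    and X: "compact_space X"
  shows "satisfies_stone_weierstrass X R N"
proof -
  have R: "comm_monoid_AbA R N" and h: "h \<in> ring_iso R K" and KM: "comm_monoid_AbA K w"
    and b: "bounded_map R N w h" and b': "bounded_map K w N (inv_into (carrier R) h)"
    using iso by (auto simp: monoid_iso_AbA_def)
  interpret normed_cring R N using R by (rule comm_monoid_AbA_imp_normed_cring)
  interpret K: normed_cring K w using KM by (rule comm_monoid_AbA_imp_normed_cring)
  interpret K: field K using K by (simp add: complete_na_valued_field_def)
  interpret R: domain R using domain_ring_iso[OF h is_cring K.domain_axioms] .
  have w_mult: "w (x \<otimes>\<^bsub>K\<^esub> y) = w x * w y" if "x \<in> carrier K" "y \<in> carrier K" for x y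
    using K that by (simp add: complete_na_valued_field_def)
  have w_add: "w (x \<oplus>\<^bsub>K\<^esub> y) \<le> max (w x) (w y)" if xy: "x \<in> carrier K" "y \<in> carrier K" for x y
  proof -
    \<comment> \<open>The ultrametric inequality for the points \<open>x\<close>, zero and
      \<open>\<ominus> y\<close> is the one for sums.\<close>
    have "norm_dist K w x (\<ominus>\<^bsub>K\<^esub> y) \<le> max (norm_dist K w x \<zero>\<^bsub>K\<^esub>) (norm_dist K w \<zero>\<^bsub>K\<^esub> (\<ominus>\<^bsub>K\<^esub> y))"
      using K xy by (simp add: complete_na_valued_field_def na_banach_ab_group_def)
    then show ?thesis using xy by (simp add: K.norm_dist_eq K.minus_eq)
  qed
  have hom: "h \<in> ring_hom R K" and bij: "bij_betw h (carrier R) (carrier K)"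
    using h by (auto simp: ring_iso_def)
  interpret H: ring_hom_cring R K h
    by unfold_locales (rule hom)
  \<comment> \<open>The norm pulled back from the field is exactly multiplicative and ultrametric,
    while \<open>N\<close> agrees with it only up to the constants \<open>C\<close> and
    \<open>C'\<close>.\<close>
  define v where "v = (\<lambda>x. w (h x))"
  obtain C where C: "C > 0" "\<And>x. x \<in> carrier R \<Longrightarrow> v x \<le> C * N x"
    using bounded_mapE[OF b norm_nonneg] unfolding v_def by blast
  obtain C' where C': "C' > 0" "\<And>y. y \<in> carrier K \<Longrightarrow> N (inv_into (carrier R) h y) \<le> C' * w y"
    using bounded_mapE[OF b' K.norm_nonneg] by blast
  have N_le: "N x \<le> C' * v x" if "x \<in> carrier R" for x
    using C'(2)[of "h x"] that bij by (simp add: v_def bij_betw_def)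
  interpret ultrametric_domain R N v
  proof
    show "continuous_map (norm_topology R N) euclideanreal v"
    proof (rule continuous_map_real_if_norm_bound[where \<phi> = "\<lambda>t. C * t"])
      show "((\<lambda>t. C * t) \<longlongrightarrow> 0) (at_right 0)" by (auto intro!: tendsto_eq_intros)
      fix x y assume xy: "x \<in> carrier R" "y \<in> carrier R"
      have "v y \<le> v (y \<ominus>\<^bsub>R\<^esub> x) + v x" "v x \<le> v (y \<ominus>\<^bsub>R\<^esub> x) + v y"
      proof -
        have hx: "h x \<in> carrier K" "h y \<in> carrier K" using xy by auto
        have e: "h y = (h y \<ominus>\<^bsub>K\<^esub> h x) \<oplus>\<^bsub>K\<^esub> h x" "h x = (h x \<ominus>\<^bsub>K\<^esub> h y) \<oplus>\<^bsub>K\<^esub> h y"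
          using hx by (simp_all add: K.minus_eq K.a_assoc K.l_neg)
        have d: "h (y \<ominus>\<^bsub>R\<^esub> x) = h y \<ominus>\<^bsub>K\<^esub> h x" using xy by (simp add: minus_eq K.minus_eq)
        show "v y \<le> v (y \<ominus>\<^bsub>R\<^esub> x) + v x"
          using K.norm_add[of "h y \<ominus>\<^bsub>K\<^esub> h x" "h x"] hx e(1) by (simp add: v_def d)
        show "v x \<le> v (y \<ominus>\<^bsub>R\<^esub> x) + v y"
          using K.norm_add[of "h x \<ominus>\<^bsub>K\<^esub> h y" "h y"] hx e(2) K.norm_minus_swap[OF hx]
          by (simp add: v_def d)
      qed
      then show "\<bar>v y - v x\<bar> \<le> C * N (y \<ominus>\<^bsub>R\<^esub> x)" using C(2)[of "y \<ominus>\<^bsub>R\<^esub> x"] xy by simp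
    qed
    show "0 \<le> v x" if "x \<in> carrier R" for x using that by (simp add: v_def K.norm_nonneg)
    show "v x = 0 \<longleftrightarrow> x = \<zero>\<^bsub>R\<^esub>" if "x \<in> carrier R" for x
      using that inj_onD[OF bij_betw_imp_inj_on[OF bij], of x "\<zero>\<^bsub>R\<^esub>"]
      by (auto simp: v_def K.norm_zero_iff)
    show "v (x \<otimes>\<^bsub>R\<^esub> y) = v x * v y" "v (x \<oplus>\<^bsub>R\<^esub> y) \<le> max (v x) (v y)"
      if "x \<in> carrier R" "y \<in> carrier R" for x y
      using that by (simp_all add: v_def w_mult w_add)
  qed
  have inverse: "\<exists>b\<in>carrier R. b \<otimes>\<^bsub>R\<^esub> a = \<one>\<^bsub>R\<^esub>" if a: "a \<in> carrier R" "a \<noteq> \<zero>\<^bsub>R\<^esub>" for a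
  proof -
    have "h a \<noteq> \<zero>\<^bsub>K\<^esub>" using v_pos[OF a] K.norm_zero_iff[of "\<zero>\<^bsub>K\<^esub>"] by (auto simp: v_def)
    then have "h a \<in> Units K" using a K.field_Units by simp
    then obtain c where c: "c \<in> carrier K" "c \<otimes>\<^bsub>K\<^esub> h a = \<one>\<^bsub>K\<^esub>" using K.Units_l_inv_ex by blast
    obtain b where b: "b \<in> carrier R" "c = h b" using bij c(1) by (auto simp: bij_betw_def)
    have "h (b \<otimes>\<^bsub>R\<^esub> a) = h \<one>\<^bsub>R\<^esub>" using a b c by simp
    then have "b \<otimes>\<^bsub>R\<^esub> a = \<one>\<^bsub>R\<^esub>" using a b by (intro inj_onD[OF bij_betw_imp_inj_on[OF bij]]) auto
    then show ?thesis using b by blast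
  qed
  show ?thesis
  proof (rule satisfies_stone_weierstrassI[OF X])
    fix B f and \<epsilon> :: real
    assume B: "subalgebra_of B R (C_alg X R N)" and sep: "separates_points X B"
      and f: "f \<in> carrier (C_alg X R N)" and \<epsilon>: "\<epsilon> > 0"
    note cl = restrict_subalgebra_closed[OF B]
    obtain a g where a: "a \<in> carrier R" "a \<noteq> \<zero>\<^bsub>R\<^esub>" and g: "restrict g (topspace X) \<in> B"
      and gR: "\<And>x. x \<in> topspace X \<Longrightarrow> g x \<in> carrier R"
      and lt: "\<And>x. x \<in> topspace X \<Longrightarrow> v (a \<otimes>\<^bsub>R\<^esub> f x \<ominus>\<^bsub>R\<^esub> g x) < (\<epsilon> / C') * v a"
      using subalgebra_approximation[OF X B sep f, of "\<epsilon> / C'"] \<epsilon> C'(1) by (metis divide_pos_pos)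
    obtain b where b: "b \<in> carrier R" "b \<otimes>\<^bsub>R\<^esub> a = \<one>\<^bsub>R\<^esub>" using inverse a by blast
    have vb: "v b * v a = 1" using v_mult[OF b(1) a(1)] b(2) v_one by simp
    define u where "u = (\<lambda>x\<in>topspace X. b \<otimes>\<^bsub>R\<^esub> g x)"
    have u: "u \<in> B" unfolding u_def by (rule cl(6)[OF b(1) g])
    then have uA: "u \<in> carrier (C_alg X R N)" using cl(1) by blast
    have "\<one>\<^bsub>R\<^esub> \<odot>\<^bsub>C_alg X R N\<^esub> u = u"
      using b gR by (auto simp: C_alg_def u_def intro!: restrict_ext)
    moreover have "N (f x \<ominus>\<^bsub>R\<^esub> u x) \<le> \<epsilon>" if x: "x \<in> topspace X" for x
    proof -
      have c: "f x \<in> carrier R" "g x \<in> carrier R" using C_alg_value[OF f x] gR[OF x] by auto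
      have "b \<otimes>\<^bsub>R\<^esub> (a \<otimes>\<^bsub>R\<^esub> f x \<ominus>\<^bsub>R\<^esub> g x) = (b \<otimes>\<^bsub>R\<^esub> a) \<otimes>\<^bsub>R\<^esub> f x \<ominus>\<^bsub>R\<^esub> b \<otimes>\<^bsub>R\<^esub> g x"
        using a b(1) c by algebra
      then have "f x \<ominus>\<^bsub>R\<^esub> u x = b \<otimes>\<^bsub>R\<^esub> (a \<otimes>\<^bsub>R\<^esub> f x \<ominus>\<^bsub>R\<^esub> g x)"
        using c x by (simp add: u_def b(2))
      then have "v (f x \<ominus>\<^bsub>R\<^esub> u x) = v b * v (a \<otimes>\<^bsub>R\<^esub> f x \<ominus>\<^bsub>R\<^esub> g x)"
        using a b(1) c by (simp add: v_mult)
      also have "\<dots> \<le> v b * ((\<epsilon> / C') * v a)"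
        using lt[OF x] b(1) by (intro mult_left_mono v_nonneg) auto
      also have "\<dots> = (v b * v a) * (\<epsilon> / C')" by simp
      finally have "v (f x \<ominus>\<^bsub>R\<^esub> u x) \<le> \<epsilon> / C'" using vb by simp
      then have "C' * v (f x \<ominus>\<^bsub>R\<^esub> u x) \<le> \<epsilon>" using C'(1) by (simp add: field_simps)
      moreover have "f x \<ominus>\<^bsub>R\<^esub> u x \<in> carrier R" using c C_alg_value[OF uA x] by simp
      ultimately show ?thesis using N_le by fastforce
    qed
    ultimately show "\<exists>u\<in>carrier (C_alg X R N). \<exists>a\<in>carrier R - {\<zero>\<^bsub>R\<^esub>}.
        a \<odot>\<^bsub>C_alg X R N\<^esub> u \<in> B \<and> (\<forall>x\<in>topspace X. N (f x \<ominus>\<^bsub>R\<^esub> u x) \<le> \<epsilon>)"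
      using uA u by (intro bexI[of _ u] bexI[of _ "\<one>\<^bsub>R\<^esub>"]) auto
  qed
qed

text \<open>A nonzero element or its negative is positive. Replacing two nonzero factors by their
  positive versions changes the product only by a sign, and products of positive elements are
  nonzero.\<close>

lemma domain_ordered_cring:
  assumes "ordered_cring R r"
  shows "domain R"
proof -
  have R: "cring R" "\<one>\<^bsub>R\<^esub> \<noteq> \<zero>\<^bsub>R\<^esub>" and lin: "linear_order_on (carrier R) r"
    and add: "\<And>a b c. a \<in> carrier R \<Longrightarrow> b \<in> carrier R \<Longrightarrow> c \<in> carrier R \<Longrightarrow> (a, b) \<in> r \<Longrightarrow>
      (a \<oplus>\<^bsub>R\<^esub> c, b \<oplus>\<^bsub>R\<^esub> c) \<in> r"
    and mult: "\<And>a b. a \<in> carrier R \<Longrightarrow> b \<in> carrier R \<Longrightarrow> (\<zero>\<^bsub>R\<^esub>, a) \<in> r \<Longrightarrow> a \<noteq> \<zero>\<^bsub>R\<^esub> \<Longrightarrow>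
      (\<zero>\<^bsub>R\<^esub>, b) \<in> r \<Longrightarrow> b \<noteq> \<zero>\<^bsub>R\<^esub> \<Longrightarrow> a \<otimes>\<^bsub>R\<^esub> b \<noteq> \<zero>\<^bsub>R\<^esub>"
    using assms unfolding ordered_cring_def by blast+
  interpret cring R by fact
  have pos: "\<exists>a'\<in>{a, \<ominus>\<^bsub>R\<^esub> a}. (\<zero>\<^bsub>R\<^esub>, a') \<in> r \<and> a' \<noteq> \<zero>\<^bsub>R\<^esub>"
    if a: "a \<in> carrier R" "a \<noteq> \<zero>\<^bsub>R\<^esub>" for a
  proof (cases "(\<zero>\<^bsub>R\<^esub>, a) \<in> r")
    case False
    then have "(a, \<zero>\<^bsub>R\<^esub>) \<in> r"
      using lin a unfolding linear_order_on_def total_on_def by auto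
    then have "(\<zero>\<^bsub>R\<^esub>, \<ominus>\<^bsub>R\<^esub> a) \<in> r" using add[of a "\<zero>\<^bsub>R\<^esub>" "\<ominus>\<^bsub>R\<^esub> a"] a by (simp add: r_neg)
    moreover have "\<ominus>\<^bsub>R\<^esub> a \<noteq> \<zero>\<^bsub>R\<^esub>" using a by (metis minus_minus minus_zero)
    ultimately show ?thesis by blast
  qed (use a in auto)
  show ?thesis
  proof
    fix a b assume ab: "a \<otimes>\<^bsub>R\<^esub> b = \<zero>\<^bsub>R\<^esub>" "a \<in> carrier R" "b \<in> carrier R"
    show "a = \<zero>\<^bsub>R\<^esub> \<or> b = \<zero>\<^bsub>R\<^esub>"
    proof (rule ccontr)
      assume "\<not> ?thesis"
      then obtain a' b' where a': "a' \<in> {a, \<ominus>\<^bsub>R\<^esub> a}" "(\<zero>\<^bsub>R\<^esub>, a') \<in> r" "a' \<noteq> \<zero>\<^bsub>R\<^esub>"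
        and b': "b' \<in> {b, \<ominus>\<^bsub>R\<^esub> b}" "(\<zero>\<^bsub>R\<^esub>, b') \<in> r" "b' \<noteq> \<zero>\<^bsub>R\<^esub>"
        using pos[OF ab(2)] pos[OF ab(3)] by blast
      then have "a' \<otimes>\<^bsub>R\<^esub> b' \<noteq> \<zero>\<^bsub>R\<^esub>" using mult[of a' b'] ab by auto
      moreover have "a' \<otimes>\<^bsub>R\<^esub> b' = \<zero>\<^bsub>R\<^esub>" using a' b' ab by (auto simp: l_minus r_minus)
      ultimately show False by simp
    qed
  qed (rule R)
qed

lemma (in normed_cring) isolated_at_zero_imp_norm_bound:
  assumes "isolated_at_zero R N"
  obtains \<delta> where "\<delta> > 0" "\<And>x. x \<in> carrier R \<Longrightarrow> x \<noteq> \<zero> \<Longrightarrow> \<delta> \<le> N x"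
proof -
  interpret M: Metric_space "carrier R" "norm_dist R N" by (rule norm_metric)
  obtain d where d: "d > 0" "M.mball \<zero> d \<subseteq> {\<zero>}"
    using assms unfolding isolated_at_zero_def norm_topology_def M.openin_mtopology by blast
  have "d \<le> N x" if x: "x \<in> carrier R" "x \<noteq> \<zero>" for x
  proof (rule ccontr)
    assume "\<not> d \<le> N x"
    then have "x \<in> M.mball \<zero> d" using x norm_neg[of x] by (simp add: norm_dist_eq minus_eq)
    then show False using d x by blast
  qed
  then show thesis using that d by blast
qed

theorem theorem8p11:
  fixes R :: "'a ring" and N :: "'a \<Rightarrow> real" and X :: "'x topology"
  assumes "comm_monoid_AbA R N \<or> comm_monoid_AbnA R N"
    and "compact_space X" and "Hausdorff_space X"
    and "(\<exists>e h. e \<ge> 0 \<and> monoid_iso_AbA R N real_ring (real_pow_norm e) h) \<or>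
         (\<exists>(K :: 'k ring) v h. complete_na_valued_field K v \<and> monoid_iso_AbA R N K v h) \<or>
         (\<exists>h. monoid_iso_AbA R N int_ring int_norm_inf h \<or>
              monoid_iso_AbA R N int_ring int_norm_triv h) \<or>
         ((\<exists>r. ordered_cring R r) \<and> isolated_at_zero R N)"
  shows "satisfies_stone_weierstrass X R N"
proof -
  have "comm_monoid_AbA R N"
    using assms(1) by (auto simp: comm_monoid_AbA_def comm_monoid_AbnA_def na_banach_ab_group_def)
  then interpret normed_cring R N by (rule comm_monoid_AbA_imp_normed_cring)
  note X = assms(2)
  \<comment> \<open>Exponent 0 is split off: the norm is then trivial and the ring discrete, while
    the case of positive exponent uses \<open>1 / e\<close>.\<close>
  consider e h where "e > 0" "monoid_iso_AbA R N real_ring (real_pow_norm e) h"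
    | h where "monoid_iso_AbA R N real_ring (real_pow_norm 0) h"
    | K :: "'k ring" and w h where "complete_na_valued_field K w" "monoid_iso_AbA R N K w h"
    | h where "monoid_iso_AbA R N int_ring int_norm_inf h"
    | h where "monoid_iso_AbA R N int_ring int_norm_triv h"
    | r where "ordered_cring R r" "isolated_at_zero R N"
    using assms(4) by (metis order_less_le)
  then show ?thesis
  proof cases
    case 1 then show ?thesis using stone_weierstrass_iso_real X by blast
  next
    case 2 then show ?thesis
      by (rule stone_weierstrass_iso_discrete_domain[OF _ domain_real_ring _ X])
        (simp add: real_pow_norm_def real_ring_def)
  next
    case 3 then show ?thesis using stone_weierstrass_iso_na_field X by blast
  next
    case 4 then show ?thesis
      by (rule stone_weierstrass_iso_discrete_domain[OF _ int.domain_axioms _ X])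
        (simp add: int_norm_inf_def)
  next
    case 5 then show ?thesis
      by (rule stone_weierstrass_iso_discrete_domain[OF _ int.domain_axioms _ X])
        (simp add: int_norm_triv_def)
  next
    case 6
    obtain \<delta> where "\<delta> > 0" "\<And>x. x \<in> carrier R \<Longrightarrow> x \<noteq> \<zero>\<^bsub>R\<^esub> \<Longrightarrow> \<delta> \<le> N x"
      using isolated_at_zero_imp_norm_bound[OF 6(2)] by blast
    then show ?thesis
      by (rule stone_weierstrass_discrete_domain[OF normed_cring_axioms domain_ordered_cring[OF 6(1)] X])
  qed
qed

end
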